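(* Let $r$ be a positive integer and $e_1,\dots,e_{2r+1}$ nonnegative integers. (i) Put $m=e_1+\cdots+e_{2r}$. Then \[\sum_{\tau\in\mathfrak{S}_{2r}}\zeta^\star(\{2\}^{e_{\tau(1)}},3,\{2\}^{e_{\tau(2)}},1,\{2\}^{e_{\tau(3)}},3,\{2\}^{e_{\tau(4)}},1,\dots,\{2\}^{e_{\tau(2r-1)}},3,\{2\}^{e_{\tau(2r)}},1)\in\mathbb{Q}\cdot\pi^{2m+4r}.\] (ii) Put $m=e_1+\cdots+e_{2r+1}$. Then \[\sum_{\tau\in\mathfrak{S}_{2r+1}}\zeta^\star(\{2\}^{e_{\tau(1)}},3,\{2\}^{e_{\tau(2)}},1,\dots,\{2\}^{e_{\tau(2r-1)}},3,\{2\}^{e_{\tau(2r)}},1,\{2\}^{e_{\tau(2r+1)}+1})\in\mathbb{Q}\cdot\pi^{2m+4r+2}.\]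
   Context: $\mathfrak{S}_k$ is the symmetric group on $\{1,\dots,k\}$. $\{2\}^a$ denotes $a$ consecutive copies of $2$ (empty if $a=0$). For a composition $\mathbf{s}=(s_1,\dots,s_\ell)$ of positive integers with $s_1\ge2$, the multiple zeta star value is $\zeta^\star(\mathbf{s})=\sum_{k_1\ge k_2\ge\cdots\ge k_\ell\ge1}\prod_{i=1}^\ell k_i^{-s_i}$. In each argument the entries $3$ and $1$ alternate, starting with $3$ after the first block of 2's. *)

theory Defs
  imports "HOL-Analysis.Analysis" "HOL-Combinatorics.Permutations"
begin

definition weakly_decreasing_tuples :: "nat \<Rightarrow> nat list set" where
  "weakly_decreasing_tuples l =
     {ks. length ks = l \<and> (\<forall>k\<in>set ks. k \<ge> 1) \<and> sorted_wrt (\<ge>) ks}"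

text \<open>
  All terms are positive, so the unordered sum agrees with the iterated one.  It converges when
  all entries of \<open>s\<close> are positive and the first one is at least 2; otherwise \<open>zeta_star s\<close> may
  carry the default value 0 of \<^const>\<open>infsum\<close>.
\<close>
definition zeta_star :: "nat list \<Rightarrow> real" where
  "zeta_star s =
     (\<Sum>\<^sub>\<infinity>ks\<in>weakly_decreasing_tuples (length s). \<Prod>i<length s. 1 / real (ks ! i) ^ (s ! i))"

text \<open>
  \<open>blocks31 n a\<close> is the composition
  \<open>{2}^(a 1), 3, {2}^(a 2), 1, {2}^(a 3), 3, \<dots>\<close>
  consisting of \<open>n\<close> blocks of 2's, each followed by a single 3 or 1.
\<close>
definition blocks31 :: "nat \<Rightarrow> (nat \<Rightarrow> nat) \<Rightarrow> nat list" where
  "blocks31 n a = concat (map (\<lambda>j. replicate (a j) 2 @ [if odd j then 3 else 1]) [1..<Suc n])"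

end

theory Submission
  imports Defs "HOL-Combinatorics.Multiset_Permutations" "HOL-Real_Asymp.Real_Asymp"
begin

text \<open>
  Let \<open>w\<^sub>n(k) = n!\<^sup>2/((n - k)! (n + k)!)\<close>. Every truncated zeta star value can be written as
  \<open>\<Sum>\<^sub>k w\<^sub>n(k) c(k)\<close>, and prefixing 1, 2 or 3 to the composition acts on the coefficients \<open>c\<close> by
  explicit formulas that come from telescoping sums of \<open>w\<^sub>n\<close>. Since \<open>w\<^sub>n(k) \<rightarrow> 1\<close>, letting
  \<open>n \<rightarrow> \<infinity>\<close> turns the star values of the theorem, up to sign, into the sums over
  \<open>l\<^sub>1 \<ge> \<dots> \<ge> l\<^sub>n \<ge> 1\<close> of \<open>2\<^sup>d \<Prod>\<^sub>j (-1)\<^bsup>l\<^sub>j\<^esup> l\<^sub>j\<^bsup>-2e\<^sub>j-2\<^esup>\<close>, with \<open>d\<close> the number of distinct \<open>l\<^sub>j\<close>.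
  Here all blocks play the same role, so summing over all permutations gives a symmetric function:
  a multilinear coefficient of \<open>\<Prod>\<^sub>l (1 + X\<^sub>l)/(1 - X\<^sub>l)\<close>, hence a rational polynomial in power sums
  over sets of odd size. These power sums are the alternating values
  \<open>\<Sum>\<^sub>l (-1)\<^sup>l l\<^bsup>-2k\<^esup>\<close>, rational multiples of \<open>\<pi>\<^bsup>2k\<^esup>\<close>.
\<close>

subsection \<open>Symmetrised sums\<close>

text \<open>An element \<open>i\<close> together with a set \<open>B\<close> avoiding it amounts to
  a set \<open>C = insert i B\<close> with a marked element.\<close>

lemma sum_Pow_remove:
  assumes "finite J"
  shows "(\<Sum>i\<in>J. \<Sum>B\<in>Pow (J - {i}). F i B) = (\<Sum>C\<in>Pow J. \<Sum>i\<in>C. F i (C - {i}))"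
proof -
  have remove: "B - {i} = B" if "B \<subseteq> J - {i}" for i B
    using that by auto
  have "(\<Sum>i\<in>J. \<Sum>B\<in>Pow (J - {i}). F i B)
      = (\<Sum>(i, B)\<in>(SIGMA i:J. Pow (J - {i})). F i B)"
    using assms by (intro sum.Sigma) auto
  also have "\<dots> = (\<Sum>(C, i)\<in>(SIGMA C:Pow J. C). F i (C - {i}))"
    by (rule sum.reindex_bij_witness
        [of _ "\<lambda>(C, i). (i, C - {i})" "\<lambda>(i, B). (insert i B, i)"])
      (auto simp: insert_absorb insert_Diff_if Diff_triv remove)
  also have "\<dots> = (\<Sum>C\<in>Pow J. \<Sum>i\<in>C. F i (C - {i}))"
    using assms by (intro sum.Sigma [symmetric]) (auto intro: finite_subset)
  finally show ?thesis .
qed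

lemma sum_Pow_swap:
  assumes "finite J"
  shows "(\<Sum>B\<in>Pow J. \<Sum>i\<in>J - B. F i B) = (\<Sum>i\<in>J. \<Sum>B\<in>Pow (J - {i}). F i B)"
proof -
  have "(\<Sum>B\<in>Pow J. \<Sum>i\<in>J - B. F i B) = (\<Sum>(B, i)\<in>(SIGMA B:Pow J. J - B). F i B)"
    using assms by (intro sum.Sigma) auto
  also have "\<dots> = (\<Sum>(i, B)\<in>(SIGMA i:J. Pow (J - {i})). F i B)"
    by (rule sum.reindex_bij_witness [of _ "\<lambda>(i, B). (B, i)" "\<lambda>(B, i). (i, B)"]) auto
  also have "\<dots> = (\<Sum>i\<in>J. \<Sum>B\<in>Pow (J - {i}). F i B)"
    using assms by (intro sum.Sigma [symmetric]) auto
  finally show ?thesis .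
qed

text \<open>Let X be the sum of the t_i \<open>x i\<close>. The multilinear part of X^n has
  coefficient n! \<open>prod x C\<close> at each \<open>C\<close> with n elements, so sums over
  \<open>Pow J\<close> of this shape are coefficients of u(X) G. Splitting off one \<open>i\<close>
  with weight \<open>x i\<close> multiplies by X, which shifts \<open>u\<close> by one.\<close>

lemma sum_weighted_remove:
  fixes x :: "'a \<Rightarrow> real" and g :: "'a set \<Rightarrow> real"
  assumes "finite J"
  shows "(\<Sum>i\<in>J. x i * (\<Sum>B\<in>Pow (J - {i}).
             u (card B) * fact (card B) * prod x B * g (J - {i} - B)))
       = (\<Sum>C\<in>Pow J. (if C = {} then 0 else u (card C - 1))
             * fact (card C) * prod x C * g (J - C))"
proof -
  have "(\<Sum>i\<in>J. x i * (\<Sum>B\<in>Pow (J - {i}).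
             u (card B) * fact (card B) * prod x B * g (J - {i} - B)))
      = (\<Sum>C\<in>Pow J. \<Sum>i\<in>C. x i * (u (card (C - {i})) * fact (card (C - {i}))
             * prod x (C - {i}) * g (J - {i} - (C - {i}))))"
    unfolding sum_distrib_left by (rule sum_Pow_remove [OF assms])
  also have "\<dots> = (\<Sum>C\<in>Pow J. (if C = {} then 0 else u (card C - 1))
             * fact (card C) * prod x C * g (J - C))"
  proof (rule sum.cong [OF refl])
    fix C assume "C \<in> Pow J"
    then have fin: "finite C"
      using assms by (auto intro: finite_subset)
    have "(\<Sum>i\<in>C. x i * (u (card (C - {i})) * fact (card (C - {i}))
             * prod x (C - {i}) * g (J - {i} - (C - {i}))))
        = (\<Sum>i\<in>C. u (card C - 1) * fact (card C - 1) * prod x C * g (J - C))"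
    proof (rule sum.cong [OF refl])
      fix i assume i: "i \<in> C"
      have "J - {i} - (C - {i}) = J - C"
        using i by auto
      moreover have "prod x C = x i * prod x (C - {i})"
        using fin i by (simp add: prod.remove)
      ultimately show "x i * (u (card (C - {i})) * fact (card (C - {i}))
             * prod x (C - {i}) * g (J - {i} - (C - {i})))
        = u (card C - 1) * fact (card C - 1) * prod x C * g (J - C)"
        using i fin by simp
    qed
    also have "\<dots> = (if C = {} then 0 else u (card C - 1))
             * fact (card C) * prod x C * g (J - C)"
    proof (cases "C = {}")
      case False
      then have "fact (card C) = real (card C) * fact (card C - 1)"
        using fin by (simp add: fact_reduce card_gt_0_iff)
      then show ?thesis using False by simp
    qed simp
    finally show "(\<Sum>i\<in>C. x i * (u (card (C - {i})) * fact (card (C - {i}))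
             * prod x (C - {i}) * g (J - {i} - (C - {i}))))
        = (if C = {} then 0 else u (card C - 1)) * fact (card C) * prod x C * g (J - C)" .
  qed
  finally show ?thesis .
qed

text \<open>For the multilinear generating functions the recursion reads G - H = X (G + H), so G + H
  = 2 G / (1 + X), which is expanded here.\<close>

lemma add_eq_sum_Pow:
  fixes x :: "'a \<Rightarrow> real" and g h :: "'a set \<Rightarrow> real"
  assumes rec: "\<And>J. finite J \<Longrightarrow> g J - h J = (\<Sum>i\<in>J. x i * (g (J - {i}) + h (J - {i})))"
    and "finite J"
  shows "g J + h J = (\<Sum>C\<in>Pow J. 2 * (-1) ^ card C * fact (card C) * prod x C * g (J - C))"
  using assms(2)
proof (induction J rule: finite_psubset_induct)
  case (psubset J)
  let ?U = "\<lambda>C. 2 * (-1) ^ card C * fact (card C) * prod x C * g (J - C) :: real"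
  have "g J + h J = 2 * g J - (\<Sum>i\<in>J. x i * (g (J - {i}) + h (J - {i})))"
    using rec [OF psubset.hyps] by simp
  also have "(\<Sum>i\<in>J. x i * (g (J - {i}) + h (J - {i})))
      = (\<Sum>i\<in>J. x i * (\<Sum>B\<in>Pow (J - {i}).
             (2 * (-1) ^ card B) * fact (card B) * prod x B * g (J - {i} - B)))"
    by (intro sum.cong refl arg_cong2 [where f = "(*)"] psubset.IH) auto
  also have "\<dots> = (\<Sum>C\<in>Pow J. (if C = {} then 0 else (2 * (-1) ^ (card C - 1)))
             * fact (card C) * prod x C * g (J - C))"
    by (rule sum_weighted_remove [OF psubset.hyps])
  \<comment> \<open>The shift by one flips the sign of every term except at the empty set, where
    \<open>2 * g J\<close> makes up for the missing term.\<close>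
  also have "\<dots> = (\<Sum>C\<in>Pow J. (if C = {} then 2 * g J else 0) - ?U C)"
  proof (rule sum.cong [OF refl])
    fix C assume "C \<in> Pow J"
    then have fin: "finite C"
      using psubset.hyps by (auto intro: finite_subset)
    show "(if C = {} then 0 else (2 * (-1) ^ (card C - 1)))
             * fact (card C) * prod x C * g (J - C) = (if C = {} then 2 * g J else 0) - ?U C"
    proof (cases "C = {}")
      case False
      then obtain n where "card C = Suc n"
        using fin by (metis card_eq_0_iff not0_implies_Suc)
      then show ?thesis using False by simp
    qed simp
  qed
  also have "\<dots> = 2 * g J - (\<Sum>C\<in>Pow J. ?U C)"
    using psubset.hyps by (simp add: sum_subtractf sum.delta)
  finally show ?case by simp
qed

text \<open>With v(X) = 2/(1 - X^2) this is 2/(1 + X) + X v(X) = v(X), multiplied by G. It brings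
  the step from \<open>N\<close> to \<open>Suc N\<close> in \<open>sym_trap_sum_insert\<close> into
  a form with even powers only.\<close>

lemma add_eq_sum_Pow_even:
  fixes x :: "'a \<Rightarrow> real" and g h :: "'a set \<Rightarrow> real"
  assumes rec: "\<And>J. finite J \<Longrightarrow> g J - h J = (\<Sum>i\<in>J. x i * (g (J - {i}) + h (J - {i})))"
    and "finite J"
  defines "v \<equiv> \<lambda>n::nat. if even n then 2 else 0 :: real"
  shows "g J + h J + (\<Sum>i\<in>J. x i * (\<Sum>B\<in>Pow (J - {i}).
             v (card B) * fact (card B) * prod x B * g (J - {i} - B)))
       = (\<Sum>B\<in>Pow J. v (card B) * fact (card B) * prod x B * g (J - B))"
proof -
  have sum: "g J + h J = (\<Sum>C\<in>Pow J. 2 * (-1) ^ card C * fact (card C) * prod x C * g (J - C))"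
    by (rule add_eq_sum_Pow [OF rec \<open>finite J\<close>])
  show ?thesis
    unfolding sum sum_weighted_remove [OF \<open>finite J\<close>] sum.distrib [symmetric]
  proof (rule sum.cong [OF refl])
    fix C assume "C \<in> Pow J"
    then have fin: "finite C"
      using \<open>finite J\<close> by (auto intro: finite_subset)
    show "2 * (-1) ^ card C * fact (card C) * prod x C * g (J - C)
        + (if C = {} then 0 else v (card C - 1)) * fact (card C) * prod x C * g (J - C)
        = v (card C) * fact (card C) * prod x C * g (J - C)"
    proof (cases "C = {}")
      case False
      then obtain n where "card C = Suc n"
        using fin by (metis card_eq_0_iff not0_implies_Suc)
      then show ?thesis using False by (simp add: v_def)
    qed (simp add: v_def)
  qed
qed

text \<open>
  Equals the sum of \<open>2\<^sup>d \<Prod>\<^sub>j f x\<^sub>j l\<^sub>j\<close> over \<open>N \<ge> l\<^sub>1 \<ge> \<dots> \<ge> l\<^sub>n \<ge> 1\<close>, where \<open>d\<close> is the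
  number of distinct values among the \<open>l\<^sub>j\<close>.
\<close>
fun trap_sum :: "('a \<Rightarrow> nat \<Rightarrow> real) \<Rightarrow> 'a list \<Rightarrow> nat \<Rightarrow> real" where
  "trap_sum f [] N = 1"
| "trap_sum f (x # xs) N = (\<Sum>l=1..N. f x l * (trap_sum f xs l + trap_sum f xs (l - 1)))"

definition sym_trap_sum :: "('a \<Rightarrow> nat \<Rightarrow> real) \<Rightarrow> 'a set \<Rightarrow> nat \<Rightarrow> real" where
  "sym_trap_sum f J N = (\<Sum>xs\<in>permutations_of_set J. trap_sum f xs N)"

text \<open>A polarised power sum: if all \<open>f i\<close> agree, it is the power sum of order
  \<open>card B\<close>.\<close>

definition power_sum :: "('a \<Rightarrow> nat \<Rightarrow> real) \<Rightarrow> 'a set \<Rightarrow> nat \<Rightarrow> real" where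
  "power_sum f B N = (\<Sum>l=1..N. \<Prod>i\<in>B. f i l)"

lemma sum_permutations_of_set_nonempty:
  assumes "finite J" "J \<noteq> {}"
  shows "(\<Sum>xs\<in>permutations_of_set J. F xs)
       = (\<Sum>x\<in>J. \<Sum>xs\<in>permutations_of_set (J - {x}). F (x # xs))"
proof -
  have "(\<Sum>xs\<in>permutations_of_set J. F xs)
      = (\<Sum>x\<in>J. \<Sum>xs\<in>(#) x ` permutations_of_set (J - {x}). F xs)"
    unfolding permutations_of_set_nonempty [OF assms(2)]
    using assms(1) by (intro sum.UNION_disjoint) auto
  also have "\<dots> = (\<Sum>x\<in>J. \<Sum>xs\<in>permutations_of_set (J - {x}). F (x # xs))"
    by (simp add: sum.reindex)
  finally show ?thesis .
qed

lemma sym_trap_sum_empty [simp]: "sym_trap_sum f {} N = 1"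
  by (simp add: sym_trap_sum_def)

lemma sym_trap_sum_0:
  assumes "finite J" "J \<noteq> {}"
  shows "sym_trap_sum f J 0 = 0"
  unfolding sym_trap_sum_def sum_permutations_of_set_nonempty [OF assms] by simp

text \<open>In a list with head \<open>x\<close> the bound \<open>N\<close> occurs only in the
  outermost sum, so raising it adds the single term \<open>l = Suc N\<close>. Sorting the
  permutations by their heads gives the recursion assumed in \<open>add_eq_sum_Pow\<close>.\<close>

lemma sym_trap_sum_Suc:
  assumes "finite J"
  shows "sym_trap_sum f J (Suc N) - sym_trap_sum f J N
       = (\<Sum>x\<in>J. f x (Suc N) * (sym_trap_sum f (J - {x}) (Suc N) + sym_trap_sum f (J - {x}) N))"
proof (cases "J = {}")
  case False
  show ?thesis
    unfolding sym_trap_sum_def sum_permutations_of_set_nonempty [OF assms False]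
      sum_subtractf [symmetric]
    by (intro sum.cong refl)
      (simp add: sum_subtractf [symmetric] sum.distrib [symmetric] sum_distrib_left)
qed simp

text \<open>
  With \<open>X\<^sub>l = \<Sum>\<^sub>i t\<^sub>i f\<^sub>i(l)\<close>, the sums \<open>sym_trap_sum f J N\<close> are the multilinear coefficients
  of \<open>\<Prod>\<^sub>l (1 + X\<^sub>l)/(1 - X\<^sub>l)\<close>, whose logarithmic derivative in \<open>t\<^sub>j\<close> is
  \<open>\<Sum>\<^sub>l 2 f\<^sub>j(l)/(1 - X\<^sub>l\<^sup>2)\<close>.
\<close>
lemma sym_trap_sum_insert:
  fixes f :: "'a \<Rightarrow> nat \<Rightarrow> real"
  assumes "finite J" "j \<notin> J"
  shows "sym_trap_sum f (insert j J) N
       = (\<Sum>B\<in>Pow J. (if even (card B) then 2 * fact (card B) else 0)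
             * power_sum f (insert j B) N * sym_trap_sum f (J - B) N)"
  using assms
proof (induction N arbitrary: J)
  case 0
  then show ?case by (simp add: sym_trap_sum_0 power_sum_def)
next
  case (Suc N)
  define g h where "g = (\<lambda>J. sym_trap_sum f J (Suc N))" and "h = (\<lambda>J. sym_trap_sum f J N)"
  define x where "x = (\<lambda>i. f i (Suc N))"
  define v where "v = (\<lambda>n::nat. if even n then 2 else 0 :: real)"
  \<comment> \<open>\<open>W\<close> carries the levels up to \<open>N\<close>, covered by the
    induction hypothesis, and \<open>V\<close> the new level \<open>Suc N\<close>.\<close>
  define W where "W = (\<lambda>B. v (card B) * fact (card B) * power_sum f (insert j B) N)"
  define V where "V = (\<lambda>B. v (card B) * fact (card B) * prod x B)"
  have rec: "g J - h J = (\<Sum>i\<in>J. x i * (g (J - {i}) + h (J - {i})))" if "finite J" for J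
    unfolding g_def h_def x_def by (rule sym_trap_sum_Suc [OF that])
  have h: "h (insert j J) = (\<Sum>B\<in>Pow J. W B * h (J - B))" if "finite J" "j \<notin> J" for J
    using Suc.IH [OF that] unfolding h_def W_def v_def
    by (simp only: mult.assoc if_distrib if_distribR) (auto intro!: sum.cong)
  have V: "g J + h J + (\<Sum>i\<in>J. x i * (\<Sum>B\<in>Pow (J - {i}). V B * g (J - {i} - B)))
       = (\<Sum>B\<in>Pow J. V B * g (J - B))" if "finite J" for J
    unfolding V_def v_def by (rule add_eq_sum_Pow_even [OF rec that])
  \<comment> \<open>An inner induction over \<open>J\<close>: the recursion for
    \<open>g (insert j J)\<close> refers to \<open>g\<close> at the sets
    \<open>insert j J - {i}\<close>.\<close>
  have "g (insert j J) = (\<Sum>B\<in>Pow J. (W B + x j * V B) * g (J - B))"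
    using Suc.prems
  proof (induction J rule: finite_psubset_induct)
    case (psubset J)
    note J = psubset.hyps psubset.prems
    have "g (insert j J) - h (insert j J)
        = x j * (g J + h J)
          + (\<Sum>i\<in>J. x i * (g (insert j J - {i}) + h (insert j J - {i})))"
      using rec [of "insert j J"] J by simp
    also have "(\<Sum>i\<in>J. x i * (g (insert j J - {i}) + h (insert j J - {i})))
        = (\<Sum>i\<in>J. x i * ((\<Sum>B\<in>Pow (J - {i}). (W B + x j * V B) * g (J - {i} - B))
             + (\<Sum>B\<in>Pow (J - {i}). W B * h (J - {i} - B))))"
    proof (intro sum.cong refl arg_cong2 [where f = "(*)"] arg_cong2 [where f = "(+)"])
      fix i assume i: "i \<in> J"
      then have ins: "insert j J - {i} = insert j (J - {i})"
        using J by auto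
      show "g (insert j J - {i}) = (\<Sum>B\<in>Pow (J - {i}). (W B + x j * V B) * g (J - {i} - B))"
        unfolding ins by (rule psubset.IH) (use i J in auto)
      show "h (insert j J - {i}) = (\<Sum>B\<in>Pow (J - {i}). W B * h (J - {i} - B))"
        unfolding ins by (rule h) (use J in auto)
    qed
    also have "\<dots> = (\<Sum>i\<in>J. \<Sum>B\<in>Pow (J - {i}).
             W B * (x i * (g (J - {i} - B) + h (J - {i} - B))))
          + x j * (\<Sum>i\<in>J. x i * (\<Sum>B\<in>Pow (J - {i}). V B * g (J - {i} - B)))"
      by (simp add: sum_distrib_left sum.distrib algebra_simps)
    \<comment> \<open>For fixed \<open>B\<close> the recursion at \<open>J - B\<close> is read
      backwards. The resulting sum of \<open>W B * h (J - B)\<close> is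
      \<open>h (insert j J)\<close>, which also stands on the left and cancels.\<close>
    also have "(\<Sum>i\<in>J. \<Sum>B\<in>Pow (J - {i}). W B * (x i * (g (J - {i} - B) + h (J - {i} - B))))
        = (\<Sum>B\<in>Pow J. W B * (g (J - B) - h (J - B)))"
      unfolding sum_Pow_swap [OF J(1), symmetric] using J(1)
      by (intro sum.cong refl)
        (simp add: rec sum_distrib_left Diff_insert2 [symmetric] Diff_insert [symmetric])
    also have "\<dots> = (\<Sum>B\<in>Pow J. W B * g (J - B)) - h (insert j J)"
      using h [OF J] by (simp add: right_diff_distrib sum_subtractf)
    finally have "g (insert j J) = (\<Sum>B\<in>Pow J. W B * g (J - B))
        + x j * (g J + h J + (\<Sum>i\<in>J. x i * (\<Sum>B\<in>Pow (J - {i}). V B * g (J - {i} - B))))"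
      by (simp add: algebra_simps)
    also have "\<dots> = (\<Sum>B\<in>Pow J. (W B + x j * V B) * g (J - B))"
      unfolding V [OF J(1)] by (simp add: sum_distrib_left sum.distrib algebra_simps)
    finally show ?case .
  qed
  also have "\<dots> = (\<Sum>B\<in>Pow J. (if even (card B) then 2 * fact (card B) else 0)
             * power_sum f (insert j B) (Suc N) * g (J - B))"
  proof (intro sum.cong refl arg_cong2 [where f = "(*)"])
    fix B assume "B \<in> Pow J"
    then have "finite B" "j \<notin> B"
      using Suc.prems by (auto intro: finite_subset)
    then show "W B + x j * V B
        = (if even (card B) then 2 * fact (card B) else 0) * power_sum f (insert j B) (Suc N)"
      by (simp add: W_def V_def v_def x_def power_sum_def algebra_simps)
  qed
  finally show ?case by (simp add: g_def)
qed

text \<open>One-line notation is injective, and both index sets have n! elements.\<close>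

lemma sum_permutes_eq_permutations_of_set:
  "(\<Sum>\<tau> | \<tau> permutes {1..n}. F (map \<tau> [1..<Suc n])) = (\<Sum>xs\<in>permutations_of_set {1..n}. F xs)"
proof (rule sum.reindex_bij_betw)
  show "bij_betw (\<lambda>\<tau>. map \<tau> [1..<Suc n]) {\<tau>. \<tau> permutes {1..n}} (permutations_of_set {1..n})"
  proof (rule bij_betw_imageI)
    show inj: "inj_on (\<lambda>\<tau>. map \<tau> [1..<Suc n]) {\<tau>. \<tau> permutes {1..n}}"
    proof (rule inj_onI)
      fix \<sigma> \<tau> assume *: "\<sigma> \<in> {\<tau>. \<tau> permutes {1..n}}" "\<tau> \<in> {\<tau>. \<tau> permutes {1..n}}"
        "map \<sigma> [1..<Suc n] = map \<tau> [1..<Suc n]"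
      show "\<sigma> = \<tau>"
      proof
        fix i
        show "\<sigma> i = \<tau> i"
          using * by (cases "i \<in> {1..n}") (auto simp: permutes_not_in simp del: upt_Suc)
      qed
    qed
    show "(\<lambda>\<tau>. map \<tau> [1..<Suc n]) ` {\<tau>. \<tau> permutes {1..n}} = permutations_of_set {1..n}"
    proof (rule card_subset_eq)
      have "set (map \<tau> [1..<Suc n]) = {1..n}" "distinct (map \<tau> [1..<Suc n])"
        if "\<tau> permutes {1..n}" for \<tau>
      proof -
        have "set (map \<tau> [1..<Suc n]) = \<tau> ` {1..n}"
          by (simp add: atLeastLessThanSuc_atLeastAtMost del: upt_Suc)
        then show "set (map \<tau> [1..<Suc n]) = {1..n}"
          using permutes_image [OF that] by simp
        show "distinct (map \<tau> [1..<Suc n])"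
          using permutes_inj_on [OF that] by (simp add: distinct_map del: upt_Suc)
      qed
      then show "(\<lambda>\<tau>. map \<tau> [1..<Suc n]) ` {\<tau>. \<tau> permutes {1..n}} \<subseteq> permutations_of_set {1..n}"
        by (auto intro!: permutations_of_setI simp del: upt_Suc)
      show "card ((\<lambda>\<tau>. map \<tau> [1..<Suc n]) ` {\<tau>. \<tau> permutes {1..n}})
          = card (permutations_of_set {1..n})"
        using inj by (simp add: card_image card_permutations del: upt_Suc)
    qed simp
  qed
qed

subsection \<open>Truncated zeta star values\<close>

text \<open>The zeta star value truncated to indices at most \<open>n\<close>, nested so that
  entries can be prefixed one at a time.\<close>

fun harmonic_star :: "nat \<Rightarrow> nat list \<Rightarrow> real" where
  "harmonic_star n [] = 1"
| "harmonic_star n (p # s) = (\<Sum>m=1..n. 1 / real m ^ p * harmonic_star m s)"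

section \<open>Zeta star values as limits of their truncations\<close>

text \<open>Each finite subset of \<open>A\<close> lies in a single \<open>D n\<close>, so by
  nonnegativity its sum is at most \<open>L\<close>; once it contains \<open>D n\<close>, its sum is
  at least \<open>sum f (D n)\<close>.\<close>

lemma has_sum_of_exhaustion:
  fixes f :: "'a \<Rightarrow> real"
  assumes nonneg: "\<And>x. x \<in> A \<Longrightarrow> f x \<ge> 0"
    and fin: "\<And>n::nat. finite (D n)" and mono: "mono D" and union: "(\<Union>n. D n) = A"
    and lim: "(\<lambda>n. sum f (D n)) \<longlonglongrightarrow> L"
  shows "(f has_sum L) A"
  unfolding has_sum_def
proof (rule increasing_tendsto)
  have le: "sum f (D n) \<le> L" for n
  proof (rule incseq_le [OF _ lim])
    show "incseq (\<lambda>n. sum f (D n))"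
    proof (rule incseq_SucI)
      fix n
      show "sum f (D n) \<le> sum f (D (Suc n))"
        using nonneg union by (intro sum_mono2 fin monoD [OF mono]) auto
    qed
  qed
  show "\<forall>\<^sub>F X in finite_subsets_at_top A. sum f X \<le> L"
  proof (rule eventually_finite_subsets_at_top_weakI)
    fix X assume X: "finite X" "X \<subseteq> A"
    have "\<exists>n. X \<subseteq> D n"
      using X
    proof (induction X rule: finite_induct)
      case (insert x X)
      then obtain m n where "X \<subseteq> D m" "x \<in> D n"
        using union by blast
      moreover have "D m \<subseteq> D (max m n)" "D n \<subseteq> D (max m n)"
        by (auto intro!: monoD [OF mono])
      ultimately show ?case by blast
    qed simp
    then obtain n where "X \<subseteq> D n" ..
    then have "sum f X \<le> sum f (D n)"
      using nonneg union by (intro sum_mono2 fin) auto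
    with le show "sum f X \<le> L" by (rule order_trans [rotated])
  qed
next
  fix y assume "y < L"
  then obtain n where n: "y < sum f (D n)"
    using order_tendstoD(1) [OF lim] eventually_happens by force
  have "\<forall>\<^sub>F X in finite_subsets_at_top A. D n \<subseteq> X \<and> X \<subseteq> A \<and> finite X"
    using fin union by (auto simp: eventually_finite_subsets_at_top intro!: exI [of _ "D n"])
  then show "\<forall>\<^sub>F X in finite_subsets_at_top A. y < sum f X"
  proof eventually_elim
    case (elim X)
    then have "sum f (D n) \<le> sum f X"
      using nonneg by (intro sum_mono2) auto
    with n show ?case by simp
  qed
qed

definition bounded_tuples :: "nat \<Rightarrow> nat \<Rightarrow> nat list set" where
  "bounded_tuples n l = {ks \<in> weakly_decreasing_tuples l. \<forall>k\<in>set ks. k \<le> n}"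

lemma bounded_tuples_0: "bounded_tuples n 0 = {[]}"
  by (auto simp: bounded_tuples_def weakly_decreasing_tuples_def)

lemma bounded_tuples_Suc:
  "bounded_tuples n (Suc l) = (\<lambda>(k, ks). k # ks) ` (SIGMA k:{1..n}. bounded_tuples k l)"
proof (intro equalityI subsetI)
  fix ks assume "ks \<in> bounded_tuples n (Suc l)"
  then show "ks \<in> (\<lambda>(k, ks). k # ks) ` (SIGMA k:{1..n}. bounded_tuples k l)"
    by (cases ks) (force simp: bounded_tuples_def weakly_decreasing_tuples_def)+
next
  fix ks assume "ks \<in> (\<lambda>(k, ks). k # ks) ` (SIGMA k:{1..n}. bounded_tuples k l)"
  then show "ks \<in> bounded_tuples n (Suc l)"
    by (fastforce simp: bounded_tuples_def weakly_decreasing_tuples_def)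
qed

lemma finite_bounded_tuples: "finite (bounded_tuples n l)"
  by (induction l arbitrary: n) (auto simp: bounded_tuples_0 bounded_tuples_Suc)

lemma harmonic_star_eq_sum:
  "harmonic_star n s
     = (\<Sum>ks\<in>bounded_tuples n (length s). \<Prod>i<length s. 1 / real (ks ! i) ^ (s ! i))"
proof (induction s arbitrary: n)
  case Nil
  then show ?case by (simp add: bounded_tuples_0)
next
  case (Cons p s)
  have inj: "inj_on (\<lambda>(k, ks). k # ks) (SIGMA k:{1..n}. bounded_tuples k (length s))"
    by (auto simp: inj_on_def)
  have "(\<Sum>ks\<in>bounded_tuples n (length (p # s)).
          \<Prod>i<length (p # s). 1 / real (ks ! i) ^ ((p # s) ! i))
      = (\<Sum>(k, ks)\<in>(SIGMA k:{1..n}. bounded_tuples k (length s)).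
          1 / real k ^ p * (\<Prod>i<length s. 1 / real (ks ! i) ^ (s ! i)))"
    unfolding bounded_tuples_Suc length_Cons sum.reindex [OF inj]
    by (simp add: case_prod_unfold prod.lessThan_Suc_shift del: prod.lessThan_Suc)
  also have "\<dots> = (\<Sum>k=1..n. \<Sum>ks\<in>bounded_tuples k (length s).
          1 / real k ^ p * (\<Prod>i<length s. 1 / real (ks ! i) ^ (s ! i)))"
    by (rule sum.Sigma [symmetric]) (auto simp: finite_bounded_tuples)
  finally show ?case by (simp add: Cons.IH sum_distrib_left)
qed

text \<open>The tuples bounded by \<open>n\<close> exhaust the index set and the terms are
  nonnegative. Convergence of the truncations yields summability, so the default value of
  \<open>infsum\<close> does not interfere.\<close>

lemma zeta_star_eq_limit:
  assumes "(\<lambda>n. harmonic_star n s) \<longlonglongrightarrow> L"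
  shows "zeta_star s = L"
  unfolding zeta_star_def
proof (rule infsumI, rule has_sum_of_exhaustion)
  show "(\<lambda>n. \<Sum>ks\<in>bounded_tuples n (length s). \<Prod>i<length s. 1 / real (ks ! i) ^ (s ! i))
      \<longlonglongrightarrow> L"
    using assms by (simp add: harmonic_star_eq_sum)
  show "mono (\<lambda>n. bounded_tuples n (length s))"
    by (force simp: mono_def bounded_tuples_def)
  show "(\<Union>n. bounded_tuples n (length s)) = weakly_decreasing_tuples (length s)"
  proof (intro equalityI subsetI)
    fix ks assume "ks \<in> weakly_decreasing_tuples (length s)"
    \<comment> \<open>Inserting 0 keeps \<open>Max\<close> defined for the empty tuple.\<close>
    then have "ks \<in> bounded_tuples (Max (insert 0 (set ks))) (length s)"
      by (simp add: bounded_tuples_def)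
    then show "ks \<in> (\<Union>n. bounded_tuples n (length s))" by blast
  qed (auto simp: bounded_tuples_def)
qed (auto intro!: prod_nonneg finite_bounded_tuples)

text \<open>\<open>binom_weight n k = n!\<^sup>2/((n - k)! (n + k)!)\<close>.\<close>
definition binom_weight :: "nat \<Rightarrow> nat \<Rightarrow> real" where
  "binom_weight n k = (\<Prod>i<k. (real n - real i) / (real n + real i + 1))"

lemma binom_weight_0 [simp]: "binom_weight n 0 = 1"
  by (simp add: binom_weight_def)

lemma binom_weight_Suc:
  "(real n + real k + 1) * binom_weight n (Suc k) = (real n - real k) * binom_weight n k"
  by (simp add: binom_weight_def)

lemma binom_weight_eq_0: "n < k \<Longrightarrow> binom_weight n k = 0"
  by (auto simp: binom_weight_def intro!: bexI [of _ n])

lemma abs_binom_weight_le_1: "\<bar>binom_weight n k\<bar> \<le> 1"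
proof (cases "k \<le> n")
  case True
  then show ?thesis
    unfolding binom_weight_def abs_prod by (intro prod_le_1) (auto simp: divide_simps)
qed (simp add: binom_weight_eq_0)

lemma binom_weight_tendsto_1: "(\<lambda>n. binom_weight n k) \<longlonglongrightarrow> 1"
proof -
  have "(\<lambda>n. binom_weight n k) \<longlonglongrightarrow> (\<Prod>i<k. 1)"
    unfolding binom_weight_def by (intro tendsto_prod) real_asymp
  then show ?thesis by simp
qed

section \<open>Differences in \<open>n\<close> and telescoping in \<open>k\<close> for the
  weights\<close>

text \<open>The ratio of the weights for n + 1 and n is (n + 1)^2/((n + 1)^2 - k^2). The form
  without division includes k = n + 1, where both sides vanish.\<close>

lemma binom_weight_mult_Suc_left:
  "binom_weight (Suc n) k * ((real n + 1)\<^sup>2 - (real k)\<^sup>2) = binom_weight n k * (real n + 1)\<^sup>2"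
proof (induction k)
  case (Suc k)
  have "binom_weight (Suc n) (Suc k) * ((real n + 1)\<^sup>2 - (real (Suc k))\<^sup>2)
      = (real n - real k) * ((real (Suc n) + real k + 1) * binom_weight (Suc n) (Suc k))"
    by (simp add: power2_eq_square algebra_simps)
  also have "\<dots> = (real n - real k) * ((real (Suc n) - real k) * binom_weight (Suc n) k)"
    by (simp only: binom_weight_Suc)
  finally have *: "binom_weight (Suc n) (Suc k) * ((real n + 1)\<^sup>2 - (real (Suc k))\<^sup>2) = \<dots>" .
  have "(real n + real k + 1)
        * (binom_weight (Suc n) (Suc k) * ((real n + 1)\<^sup>2 - (real (Suc k))\<^sup>2))
      = (real n - real k) * (binom_weight (Suc n) k * ((real n + 1)\<^sup>2 - (real k)\<^sup>2))"
    unfolding * by (simp add: power2_eq_square algebra_simps)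
  also have "\<dots> = ((real n - real k) * binom_weight n k) * (real n + 1)\<^sup>2"
    by (simp add: Suc.IH)
  also have "\<dots> = (real n + real k + 1) * (binom_weight n (Suc k) * (real n + 1)\<^sup>2)"
    by (simp only: binom_weight_Suc [symmetric] mult.assoc)
  finally show ?case
    by (simp add: add_nonneg_eq_0_iff)
qed simp

text \<open>The increment of the weight as n grows; it explains the factor (l/n)^2 in
  \<open>binom_rep_Cons\<close>.\<close>

lemma binom_weight_diff:
  "binom_weight n k + binom_weight (Suc n) k * (real k / real (Suc n))\<^sup>2 = binom_weight (Suc n) k"
  using binom_weight_mult_Suc_left [of n k] by (simp add: divide_simps algebra_simps)

text \<open>By \<open>binom_weight_Suc\<close>, 2 l w(l) = (n - l + 1) w(l - 1) - (n - l) w(l) for w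
  = \<open>binom_weight n\<close>, so the sum telescopes. At m = n the upper boundary term
  vanishes.\<close>

lemma sum_binom_weight:
  assumes "k \<le> m"
  shows "(\<Sum>l=Suc k..m. 2 * real l * binom_weight n l)
       = (real n - real k) * binom_weight n k - (real n - real m) * binom_weight n m"
  using assms
proof (induction m rule: dec_induct)
  case (step m)
  then show ?case
    using binom_weight_Suc [of n m] by (simp add: algebra_simps)
qed simp

text \<open>Here 2 n w(l) = (n - l) w(l) + (n - l + 1) w(l - 1), and the alternating sign makes this
  telescope.\<close>

lemma sum_alternating_binom_weight:
  assumes "k \<le> m"
  shows "2 * real n * (\<Sum>l=Suc k..m. (-1) ^ l * binom_weight n l)
       = (-1) ^ m * (real n - real m) * binom_weight n m
         - (-1) ^ k * (real n - real k) * binom_weight n k"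
  using assms
proof (induction m rule: dec_induct)
  case (step m)
  have "(-1) ^ m * ((real n + real m + 1) * binom_weight n (Suc m))
      = (-1) ^ m * ((real n - real m) * binom_weight n m)"
    by (simp only: binom_weight_Suc)
  with step show ?case by (simp add: algebra_simps)
qed simp

section \<open>How prefixing an entry acts on the coefficients\<close>

text \<open>At n = 0 the truncation of the empty composition is 1 while the sum is empty, hence the
  restriction to n >= 1.\<close>

definition binom_rep :: "nat list \<Rightarrow> (nat \<Rightarrow> real) \<Rightarrow> bool" where
  "binom_rep s c \<longleftrightarrow> (\<forall>n\<ge>1. harmonic_star n s = (\<Sum>k=1..n. binom_weight n k * c k))"

lemma binom_rep_cong:
  assumes "binom_rep s c" "\<And>k. k \<ge> 1 \<Longrightarrow> c k = c' k"
  shows "binom_rep s c'"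
  using assms unfolding binom_rep_def by simp

text \<open>Induction on n. The new summand is expanded by \<open>key\<close>, and exchanging the
  sums leaves \<open>C l\<close> times w_n(l) (l/n)^2, the increment of the weight by
  \<open>binom_weight_diff\<close>. As \<open>d\<close> does not depend on n, the increments add
  up.\<close>

lemma binom_rep_Cons:
  assumes rep: "binom_rep s c"
    and key: "\<And>n k. 1 \<le> k \<Longrightarrow> k \<le> n \<Longrightarrow>
      binom_weight n k / real n ^ p = (\<Sum>l=k..n. binom_weight n l * (real l / real n)\<^sup>2 * d k l)"
  shows "binom_rep (p # s) (\<lambda>l. \<Sum>k=1..l. c k * d k l)"
proof -
  define C where "C = (\<lambda>l. \<Sum>k=1..l. c k * d k l)"
  have "harmonic_star n (p # s) = (\<Sum>l=1..n. binom_weight n l * C l)" for n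
  proof (induction n)
    case (Suc n)
    define w where "w = (\<lambda>l. binom_weight (Suc n) l * (real l / real (Suc n))\<^sup>2)"
    have "1 / real (Suc n) ^ p * harmonic_star (Suc n) s
        = (\<Sum>k=1..Suc n. c k * (binom_weight (Suc n) k / real (Suc n) ^ p))"
    proof -
      have "harmonic_star (Suc n) s = (\<Sum>k=1..Suc n. binom_weight (Suc n) k * c k)"
        using rep unfolding binom_rep_def by simp
      then show ?thesis
        by (simp only: sum_distrib_left) (simp add: mult_ac del: sum.cl_ivl_Suc)
    qed
    also have "\<dots> = (\<Sum>k=1..Suc n. \<Sum>l=k..Suc n. w l * (c k * d k l))"
      by (intro sum.cong refl, subst key) (auto simp: w_def sum_distrib_left mult_ac simp del: sum.cl_ivl_Suc)
    also have "\<dots> = (\<Sum>l=1..Suc n. \<Sum>k=1..l. w l * (c k * d k l))"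
    proof -
      have "{l \<in> {1..Suc n}. k \<le> l} = {k..Suc n}" if "k \<in> {1..Suc n}" for k
        using that by auto
      moreover have "{k \<in> {1..Suc n}. k \<le> l} = {1..l}" if "l \<in> {1..Suc n}" for l
        using that by auto
      ultimately show ?thesis
        using sum.swap_restrict [of "{1..Suc n}" "{1..Suc n}" "\<lambda>k l. w l * (c k * d k l)" "(\<le>)"]
        by (simp del: sum.cl_ivl_Suc)
    qed
    also have "\<dots> = (\<Sum>l=1..Suc n. w l * C l)"
      by (simp add: C_def sum_distrib_left del: sum.cl_ivl_Suc)
    finally have "harmonic_star (Suc n) (p # s)
        = (\<Sum>l=1..n. binom_weight n l * C l) + (\<Sum>l=1..Suc n. w l * C l)"
      using Suc.IH by simp
    \<comment> \<open>The added term has weight 0.\<close>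
    also have "(\<Sum>l=1..n. binom_weight n l * C l) = (\<Sum>l=1..Suc n. binom_weight n l * C l)"
      by (simp add: binom_weight_eq_0)
    also have "\<dots> + (\<Sum>l=1..Suc n. w l * C l) = (\<Sum>l=1..Suc n. binom_weight (Suc n) l * C l)"
      unfolding sum.distrib [symmetric] ring_distribs(2) [symmetric] w_def binom_weight_diff ..
    finally show ?case .
  qed simp
  then show ?thesis
    unfolding binom_rep_def C_def by blast
qed

text \<open>The weights 1 on the diagonal and 2 off it turn differences of \<open>u\<close> into
  sums of neighbours, the shape in which \<open>trap_sum\<close> recurs.\<close>

lemma sum_twice_except_last:
  fixes u :: "nat \<Rightarrow> real"
  assumes "u 0 = 0" "l \<ge> 1"
  shows "(\<Sum>k=1..l. (u k - u (k - 1)) * (if l = k then 1 else 2)) = u l + u (l - 1)"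
proof -
  have "(\<Sum>k=1..l. (u k - u (k - 1)) * (if l = k then 1 else 2))
      = (\<Sum>k=1..l. 2 * (u k - u (k - 1)) - (if l = k then u k - u (k - 1) else 0))"
    by (intro sum.cong) auto
  also have "\<dots> = 2 * (\<Sum>k=1..l. u k - u (k - 1)) - (u l - u (l - 1))"
    using assms(2) by (simp add: sum_subtractf sum_distrib_left [symmetric])
  also have "(\<Sum>k=1..l. u k - u (k - 1)) = u l - u 0"
    using sum_telescope'' [of 0 l u] by simp
  finally show ?thesis using assms(1) by simp
qed

text \<open>The kernel is 1/l on the diagonal and 2/l off it. \<open>key\<close> is
  \<open>sum_binom_weight\<close> at m = n, as k w(k) + (n - k) w(k) = n w(k).\<close>

lemma binom_rep_Cons_1:
  assumes "binom_rep s (\<lambda>k. \<gamma> * (u k - u (k - 1)))" "u 0 = 0"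
  shows "binom_rep (1 # s) (\<lambda>l. \<gamma> * (u l + u (l - 1)) / real l)"
proof -
  have "binom_rep (1 # s) (\<lambda>l. \<Sum>k=1..l. \<gamma> * (u k - u (k - 1)) * ((if l = k then 1 else 2) / real l))"
  proof (rule binom_rep_Cons [OF assms(1)])
    fix n k :: nat assume k: "1 \<le> k" "k \<le> n"
    have "(\<Sum>l=k..n. binom_weight n l * (real l / real n)\<^sup>2 * ((if l = k then 1 else 2) / real l))
        = (\<Sum>l=k..n. real l * (if l = k then 1 else 2) * binom_weight n l) / (real n)\<^sup>2"
      unfolding sum_divide_distrib
      using k by (intro sum.cong refl) (auto simp: power2_eq_square)
    also have "(\<Sum>l=k..n. real l * (if l = k then 1 else 2) * binom_weight n l)
        = real k * binom_weight n k + (\<Sum>l=Suc k..n. 2 * real l * binom_weight n l)"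
      using k by (simp add: sum.atLeast_Suc_atMost mult_ac)
    also have "\<dots> = real n * binom_weight n k"
      using sum_binom_weight [OF k(2), of n] by (simp add: algebra_simps)
    finally show "binom_weight n k / real n ^ 1
        = (\<Sum>l=k..n. binom_weight n l * (real l / real n)\<^sup>2 * ((if l = k then 1 else 2) / real l))"
      using k by (simp add: power2_eq_square)
  qed
  then show ?thesis
  proof (rule binom_rep_cong)
    fix l :: nat assume l: "l \<ge> 1"
    have "(\<Sum>k=1..l. \<gamma> * (u k - u (k - 1)) * ((if l = k then 1 else 2) / real l))
        = \<gamma> * (\<Sum>k=1..l. (u k - u (k - 1)) * (if l = k then 1 else 2)) / real l"
      by (simp add: sum_distrib_left sum_divide_distrib mult_ac)
    then show "(\<Sum>k=1..l. \<gamma> * (u k - u (k - 1)) * ((if l = k then 1 else 2) / real l))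
        = \<gamma> * (u l + u (l - 1)) / real l"
      using sum_twice_except_last [of u l, OF assms(2) l] by simp
  qed
qed

text \<open>The kernel comes from the alternating telescoping sum at m = n. The factor k (-1)^k in
  the hypothesis cancels (-1)^k/k in the kernel, leaving only the weights 1 and 2.\<close>

lemma binom_rep_Cons_3:
  assumes "binom_rep s (\<lambda>k. \<gamma> * real k * (-1) ^ k * (u k - u (k - 1)))" "u 0 = 0"
  shows "binom_rep (3 # s) (\<lambda>l. \<gamma> * (-1) ^ l * (u l + u (l - 1)) / (real l)\<^sup>2)"
proof -
  define d where "d = (\<lambda>k l. (-1) ^ k * (-1) ^ l * (if l = k then 1 else 2) / (real k * (real l)\<^sup>2))"
  have "binom_rep (3 # s) (\<lambda>l. \<Sum>k=1..l. \<gamma> * real k * (-1) ^ k * (u k - u (k - 1)) * d k l)"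
  proof (rule binom_rep_Cons [OF assms(1)])
    fix n k :: nat assume k: "1 \<le> k" "k \<le> n"
    have "(\<Sum>l=k..n. binom_weight n l * (real l / real n)\<^sup>2 * d k l)
        = (\<Sum>l=k..n. (if l = k then 1 else 2) * ((-1) ^ l * binom_weight n l))
            * ((-1) ^ k / (real k * (real n)\<^sup>2))"
      unfolding sum_distrib_right d_def
      using k by (intro sum.cong refl) (auto simp: power2_eq_square mult_ac)
    also have "(\<Sum>l=k..n. (if l = k then 1 else 2) * ((-1) ^ l * binom_weight n l))
        = (-1) ^ k * binom_weight n k + 2 * (\<Sum>l=Suc k..n. (-1) ^ l * binom_weight n l)"
      using k by (simp add: sum.atLeast_Suc_atMost sum_distrib_left)
    also have "\<dots> = (-1) ^ k * real k / real n * binom_weight n k"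
      using sum_alternating_binom_weight [OF k(2), of n] k
      by (simp add: field_simps)
    finally show "binom_weight n k / real n ^ 3
        = (\<Sum>l=k..n. binom_weight n l * (real l / real n)\<^sup>2 * d k l)"
      using k by (simp add: power2_eq_square power3_eq_cube mult_ac)
  qed
  then show ?thesis
  proof (rule binom_rep_cong)
    fix l :: nat assume l: "l \<ge> 1"
    have "(\<Sum>k=1..l. \<gamma> * real k * (-1) ^ k * (u k - u (k - 1)) * d k l)
        = (\<gamma> * (-1) ^ l / (real l)\<^sup>2) * (\<Sum>k=1..l. (u k - u (k - 1)) * (if l = k then 1 else 2))"
      unfolding sum_distrib_left d_def
      by (intro sum.cong refl) (auto simp: mult_ac)
    then show "(\<Sum>k=1..l. \<gamma> * real k * (-1) ^ k * (u k - u (k - 1)) * d k l)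
        = \<gamma> * (-1) ^ l * (u l + u (l - 1)) / (real l)\<^sup>2"
      using sum_twice_except_last [of u l, OF assms(2) l] by simp
  qed
qed

lemma binom_rep_Cons_2:
  assumes "binom_rep s c"
  shows "binom_rep (2 # s) (\<lambda>k. c k / (real k)\<^sup>2)"
proof -
  have "binom_rep (2 # s) (\<lambda>l. \<Sum>k=1..l. c k * (if l = k then 1 / (real k)\<^sup>2 else 0))"
  proof (rule binom_rep_Cons [OF assms])
    fix n k :: nat assume k: "1 \<le> k" "k \<le> n"
    have "(\<Sum>l=k..n. binom_weight n l * (real l / real n)\<^sup>2 * (if l = k then 1 / (real k)\<^sup>2 else 0))
        = (\<Sum>l=k..n. if l = k then binom_weight n k / (real n)\<^sup>2 else 0)"
      using k by (intro sum.cong refl) (auto simp: power2_eq_square)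
    then show "binom_weight n k / (real n)\<^sup>2
      = (\<Sum>l=k..n. binom_weight n l * (real l / real n)\<^sup>2 * (if l = k then 1 / (real k)\<^sup>2 else 0))"
      using k by simp
  qed
  then show ?thesis
  proof (rule binom_rep_cong)
    fix l :: nat assume "l \<ge> 1"
    have "(\<Sum>k=1..l. c k * (if l = k then 1 / (real k)\<^sup>2 else 0))
        = (\<Sum>k=1..l. if l = k then c l / (real l)\<^sup>2 else 0)"
      by (intro sum.cong) auto
    then show "(\<Sum>k=1..l. c k * (if l = k then 1 / (real k)\<^sup>2 else 0)) = c l / (real l)\<^sup>2"
      using \<open>l \<ge> 1\<close> by simp
  qed
qed

lemma binom_rep_replicate_2:
  assumes "binom_rep s c"
  shows "binom_rep (replicate e 2 @ s) (\<lambda>k. c k / real k ^ (2 * e))"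
proof (induction e)
  case (Suc e)
  show ?case
    using binom_rep_Cons_2 [OF Suc] by (simp add: power2_eq_square mult_ac)
qed (use assms in simp)

text \<open>This is the vanishing, for n >= 1, of the alternating sum of the binomial coefficients
  of 2n, divided by the central one and folded by symmetry.\<close>

lemma binom_rep_Nil: "binom_rep [] (\<lambda>k. - 2 * (-1) ^ k)"
  unfolding binom_rep_def
proof (intro allI impI)
  fix n :: nat assume "n \<ge> 1"
  have "real n * (2 * (\<Sum>k=1..n. (-1) ^ k * binom_weight n k)) = real n * (- 1)"
    using sum_alternating_binom_weight [of 0 n n] by simp
  then have "2 * (\<Sum>k=1..n. (-1) ^ k * binom_weight n k) = - 1"
    using \<open>n \<ge> 1\<close> by (subst (asm) mult_cancel_left) simp
  then show "harmonic_star n [] = (\<Sum>k=1..n. binom_weight n k * (- 2 * (-1) ^ k))"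
    by (simp add: sum_distrib_left sum_negf mult_ac)
qed

text \<open>The coefficients for \<open>[]\<close> are the differences of u(k) = 1 - (-1)^k, and
  u(k) + u(k - 1) = 2. Since \<open>trap_sum f [] = 1\<close>, this is the hypothesis of
  \<open>binom_rep_block\<close> with \<open>xs = []\<close> and
  \<open>\<gamma> = 1\<close>.\<close>

lemma binom_rep_1: "binom_rep [1] (\<lambda>k. 2 / real k)"
proof -
  have "binom_rep [] (\<lambda>k. 1 * ((if k = 0 then 0 else 1 - (-1) ^ k) - (if k - 1 = 0 then 0 else 1 - (-1) ^ (k - 1))))"
  proof (rule binom_rep_cong [OF binom_rep_Nil])
    fix k :: nat assume "k \<ge> 1"
    then obtain m where "k = Suc m" by (cases k) auto
    then show "- 2 * (-1) ^ k = 1 * ((if k = 0 then 0 else 1 - (-1) ^ k)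
        - (if k - 1 = 0 then 0 else 1 - (-1) ^ (k - 1)) :: real)"
      by simp
  qed
  from binom_rep_Cons_1 [OF this] have "binom_rep [1] (\<lambda>k. 1 * ((if k = 0 then 0 else 1 - (-1) ^ k)
        + (if k - 1 = 0 then 0 else 1 - (-1) ^ (k - 1))) / real k)"
    by simp
  then show ?thesis
  proof (rule binom_rep_cong)
    fix k :: nat assume "k \<ge> 1"
    then obtain m where "k = Suc m" by (cases k) auto
    then show "1 * ((if k = 0 then 0 else 1 - (-1) ^ k)
        + (if k - 1 = 0 then 0 else 1 - (-1) ^ (k - 1))) / real k = 2 / real k"
      by simp
  qed
qed

lemma trap_sum_diff:
  assumes "k \<ge> 1"
  shows "trap_sum f (x # xs) k - trap_sum f (x # xs) (k - 1)
       = f x k * (trap_sum f xs k + trap_sum f xs (k - 1))"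
proof -
  obtain m where "k = Suc m" using assms by (cases k) auto
  then show ?thesis by simp
qed

text \<open>The factor k (-1)^k needed before a 3 and the factor (-1)^k/k^2 it produces complete the
  powers of 1/k from the 2's to \<open>f x k\<close> and \<open>f y k\<close>. Thus blocks before a
  3 and before a 1 contribute alike, which makes the symmetrisation work.\<close>

lemma binom_rep_block:
  fixes e :: "'a \<Rightarrow> nat"
  defines "f \<equiv> \<lambda>i k. (-1) ^ k / real k ^ (2 * e i + 2)"
  assumes rep: "binom_rep (1 # s) (\<lambda>l. \<gamma> * (trap_sum f xs l + trap_sum f xs (l - 1)) / real l)"
  shows "binom_rep (replicate (e y) 2 @ 3 # replicate (e x) 2 @ 1 # s)
    (\<lambda>k. \<gamma> * (trap_sum f (y # x # xs) k - trap_sum f (y # x # xs) (k - 1)))"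
proof -
  let ?u = "trap_sum f (x # xs)"
  have "binom_rep (replicate (e x) 2 @ 1 # s) (\<lambda>k. \<gamma> * real k * (-1) ^ k * (?u k - ?u (k - 1)))"
  proof (rule binom_rep_cong [OF binom_rep_replicate_2 [OF rep]])
    fix k :: nat assume k: "k \<ge> 1"
    show "\<gamma> * (trap_sum f xs k + trap_sum f xs (k - 1)) / real k / real k ^ (2 * e x)
        = \<gamma> * real k * (-1) ^ k * (?u k - ?u (k - 1))"
      unfolding trap_sum_diff [OF k]
      using k by (simp add: f_def field_simps power_add power2_eq_square flip: power_mult_distrib)
  qed
  from binom_rep_replicate_2 [OF binom_rep_Cons_3 [OF this], of "e y"] show ?thesis
  proof (rule binom_rep_cong)
    fix k :: nat assume k: "k \<ge> 1"
    show "\<gamma> * (-1) ^ k * (?u k + ?u (k - 1)) / (real k)\<^sup>2 / real k ^ (2 * e y)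
        = \<gamma> * (trap_sum f (y # x # xs) k - trap_sum f (y # x # xs) (k - 1))"
      unfolding trap_sum_diff [OF k, of f y]
      by (simp add: f_def power_add power2_eq_square mult_ac)
  qed simp
qed

subsection \<open>Even zeta values\<close>

definition rat_pi :: "nat \<Rightarrow> real \<Rightarrow> bool" where
  "rat_pi n x \<longleftrightarrow> (\<exists>q\<in>\<rat>. x = q * pi ^ n)"

lemma rat_pi_mult: "rat_pi m x \<Longrightarrow> rat_pi n y \<Longrightarrow> rat_pi (m + n) (x * y)"
  unfolding rat_pi_def
  by (elim bexE) (rule bexI [where x = "p * q" for p q], auto simp: power_add)

lemma rat_pi_cmult: "c \<in> \<rat> \<Longrightarrow> rat_pi n x \<Longrightarrow> rat_pi n (c * x)"
  using rat_pi_mult [of 0 c n x] by (simp add: rat_pi_def)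

lemma rat_pi_add: "rat_pi n x \<Longrightarrow> rat_pi n y \<Longrightarrow> rat_pi n (x + y)"
  unfolding rat_pi_def by (metis Rats_add distrib_right)

lemma rat_pi_sum: "(\<And>i. i \<in> A \<Longrightarrow> rat_pi n (x i)) \<Longrightarrow> rat_pi n (\<Sum>i\<in>A. x i)"
  by (induction A rule: infinite_finite_induct)
    (auto intro!: rat_pi_add, auto simp: rat_pi_def intro!: bexI [of _ 0])

definition zeta_partial :: "nat \<Rightarrow> nat \<Rightarrow> real" where
  "zeta_partial N k = (\<Sum>a=1..N. (1 / (real a)\<^sup>2) ^ k)"

text \<open>This is zeta(2k) for k >= 1: the term \<open>a = 0\<close> is then 0, as 1/0 =
  0.\<close>

definition zeta_even :: "nat \<Rightarrow> real" where
  "zeta_even k = (\<Sum>a. (1 / (real a)\<^sup>2) ^ k)"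

lemma summable_inverse_squares_power:
  assumes "k \<ge> 1"
  shows "summable (\<lambda>a. (1 / (real a)\<^sup>2) ^ k)"
  using inverse_power_summable [of "2 * k", where 'a = real] assms
  by (simp add: power_one_over power_mult inverse_eq_divide)

lemma zeta_partial_tendsto:
  assumes "k \<ge> 1"
  shows "(\<lambda>N. zeta_partial N k) \<longlonglongrightarrow> zeta_even k"
proof -
  have "zeta_partial N k = (\<Sum>a\<le>N. (1 / (real a)\<^sup>2) ^ k)" for N
    unfolding zeta_partial_def
    using assms by (intro sum.mono_neutral_left) (auto simp: not_le zero_power Suc_le_eq)
  then show ?thesis
    using summable_LIMSEQ' [OF summable_inverse_squares_power [OF assms]]
    by (simp add: zeta_even_def)
qed

section \<open>Euler's recursion from truncated sums\<close>

text \<open>For u = 1/a^2 and v = 1/b^2 the factor 1/v - 1/u is b^2 - a^2.\<close>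

lemma geometric_convolution:
  fixes u v :: real
  assumes "u \<noteq> 0" "v \<noteq> 0"
  shows "(1 / v - 1 / u) * (\<Sum>k=1..m. u ^ k * v ^ (Suc m - k)) = u ^ m - v ^ m"
proof (induction m)
  case (Suc m)
  have "(\<Sum>k=1..Suc m. u ^ k * v ^ (Suc (Suc m) - k))
      = v * (\<Sum>k=1..m. u ^ k * v ^ (Suc m - k)) + u ^ Suc m * v"
    by (simp add: sum_distrib_left Suc_diff_le mult_ac)
  then have "(1 / v - 1 / u) * (\<Sum>k=1..Suc m. u ^ k * v ^ (Suc (Suc m) - k))
      = v * ((1 / v - 1 / u) * (\<Sum>k=1..m. u ^ k * v ^ (Suc m - k))) + (1 / v - 1 / u) * u ^ Suc m * v"
    by (simp add: algebra_simps)
  also have "\<dots> = v * (u ^ m - v ^ m) + (1 / v - 1 / u) * u ^ Suc m * v"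
    by (simp only: Suc.IH)
  also have "\<dots> = u ^ Suc m - v ^ Suc m"
    using assms by (simp add: field_simps)
  finally show ?case .
qed simp

text \<open>The diagonal terms of the inner sum on the right vanish, as \<open>1 / 0 = 0\<close>.\<close>
lemma zeta_partial_convolution:
  "(\<Sum>k=1..m. zeta_partial N k * zeta_partial N (Suc m - k))
     = real m * zeta_partial N (Suc m)
       + 2 * (\<Sum>a=1..N. (1 / (real a)\<^sup>2) ^ m * (\<Sum>b=1..N. 1 / ((real b)\<^sup>2 - (real a)\<^sup>2)))"
proof -
  define u where "u = (\<lambda>a::nat. 1 / (real a)\<^sup>2)"
  define q where "q = (\<lambda>a b. 1 / ((real b)\<^sup>2 - (real a)\<^sup>2))"
  have inner: "(\<Sum>k=1..m. u a ^ k * u b ^ (Suc m - k))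
      = (if a = b then real m * u a ^ Suc m else 0) + (u a ^ m * q a b + u b ^ m * q b a)"
    if "a \<in> {1..N}" "b \<in> {1..N}" for a b
  proof (cases "a = b")
    case True
    have "(\<Sum>k=1..m. u a ^ k * u a ^ (Suc m - k)) = (\<Sum>k=1..m. u a ^ Suc m)"
      by (intro sum.cong) (auto simp flip: power_add)
    then show ?thesis using True by (simp add: q_def)
  next
    case False
    have "((real b)\<^sup>2 - (real a)\<^sup>2) * (\<Sum>k=1..m. u a ^ k * u b ^ (Suc m - k)) = u a ^ m - u b ^ m"
      using geometric_convolution [of "u a" "u b" m] that by (simp add: u_def)
    moreover have "(real b)\<^sup>2 - (real a)\<^sup>2 \<noteq> 0"
      using False by (simp add: power2_eq_iff_nonneg)
    moreover have "q b a = - q a b"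
      unfolding q_def by (metis minus_diff_eq minus_divide_right)
    moreover have "S = (x - y) * (1 / D)" if "D * S = x - y" "D \<noteq> 0" for D S x y :: real
      using that by (simp add: field_simps)
    ultimately have "(\<Sum>k=1..m. u a ^ k * u b ^ (Suc m - k)) = (u a ^ m - u b ^ m) * q a b"
      unfolding q_def by blast
    then show ?thesis
      using False \<open>q b a = - q a b\<close> by (simp add: algebra_simps)
  qed
  have "(\<Sum>k=1..m. zeta_partial N k * zeta_partial N (Suc m - k))
      = (\<Sum>k=1..m. \<Sum>a=1..N. \<Sum>b=1..N. u a ^ k * u b ^ (Suc m - k))"
    by (simp add: zeta_partial_def u_def sum_product)
  also have "\<dots> = (\<Sum>a=1..N. \<Sum>k=1..m. \<Sum>b=1..N. u a ^ k * u b ^ (Suc m - k))"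
    by (rule sum.swap)
  also have "\<dots> = (\<Sum>a=1..N. \<Sum>b=1..N. \<Sum>k=1..m. u a ^ k * u b ^ (Suc m - k))"
    by (intro sum.cong refl sum.swap)
  also have "\<dots> = (\<Sum>a=1..N. \<Sum>b=1..N.
      (if a = b then real m * u a ^ Suc m else 0) + (u a ^ m * q a b + u b ^ m * q b a))"
    by (intro sum.cong refl inner)
  also have "\<dots> = (\<Sum>a=1..N. \<Sum>b=1..N. if a = b then real m * u a ^ Suc m else 0)
      + ((\<Sum>a=1..N. \<Sum>b=1..N. u a ^ m * q a b) + (\<Sum>a=1..N. \<Sum>b=1..N. u b ^ m * q b a))"
    by (simp only: sum.distrib)
  \<comment> \<open>Exchanging a and b identifies the two off-diagonal sums, hence the factor
    2.\<close>
  also have "(\<Sum>a=1..N. \<Sum>b=1..N. u b ^ m * q b a) = (\<Sum>a=1..N. \<Sum>b=1..N. u a ^ m * q a b)"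
    by (rule sum.swap)
  also have "(\<Sum>a=1..N. \<Sum>b=1..N. if a = b then real m * u a ^ Suc m else 0)
      = real m * zeta_partial N (Suc m)"
    by (simp add: zeta_partial_def u_def sum_distrib_left)
  finally show ?thesis
    by (simp add: u_def q_def sum_distrib_left)
qed

text \<open>The term b = a is 1/0 = 0. The terms b > a give \<open>harm (N - a)\<close>, and those
  with b < a give minus the sum \<open>harm a - 1 / real a\<close>.\<close>

lemma sum_inverse_diff:
  assumes "a \<le> N"
  shows "(\<Sum>b=1..N. 1 / (real b - real a)) = harm (N - a) - harm a + 1 / real a"
  using assms
proof (induction N rule: dec_induct)
  case base
  have "(\<Sum>b=1..a. 1 / (real b - real a)) = - (\<Sum>j<a. 1 / real j)"
    unfolding sum_negf [symmetric]
    by (rule sum.reindex_bij_witness [of _ "\<lambda>j. a - j" "\<lambda>b. a - b"])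
      (auto simp: of_nat_diff, metis minus_diff_eq minus_divide_right)
  also have "(\<Sum>j<a. 1 / real j) = harm a - 1 / real a"
  proof (induction a)
    case (Suc a)
    then show ?case by (cases "a = 0") (simp_all add: harm_Suc inverse_eq_divide)
  qed (simp add: harm_def)
  finally show ?case by (simp add: harm_def)
next
  case (step N)
  then show ?case by (simp add: Suc_diff_le harm_Suc inverse_eq_divide of_nat_diff)
qed

lemma sum_inverse_add: "(\<Sum>b=1..N. 1 / (real b + real a)) = harm (N + a) - harm a"
  by (induction N) (simp_all add: harm_Suc inverse_eq_divide add_ac)

text \<open>Partial fractions in b. At b = a they leave -1/(4 a^2) where the term itself is 0;
  correcting this and using the 1/a of \<open>sum_inverse_diff\<close> makes 1/4 + 1/2 =
  3/4.\<close>

lemma sum_inverse_diff_squares: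
  assumes "1 \<le> a" "a \<le> N"
  shows "(\<Sum>b=1..N. 1 / ((real b)\<^sup>2 - (real a)\<^sup>2))
       = 3 / 4 * (1 / (real a)\<^sup>2) - (harm (N + a) - harm (N - a)) / (2 * real a)"
proof -
  have "(\<Sum>b=1..N. 1 / ((real b)\<^sup>2 - (real a)\<^sup>2))
      = (\<Sum>b=1..N. (1 / (real b - real a) - 1 / (real b + real a)) / (2 * real a)
          + (if b = a then 1 / (4 * (real a)\<^sup>2) else 0))"
  proof (rule sum.cong [OF refl])
    fix b assume "b \<in> {1..N}"
    show "1 / ((real b)\<^sup>2 - (real a)\<^sup>2)
        = (1 / (real b - real a) - 1 / (real b + real a)) / (2 * real a)
          + (if b = a then 1 / (4 * (real a)\<^sup>2) else 0)"
    proof (cases "b = a")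
      case False
      have "(real b)\<^sup>2 - (real a)\<^sup>2 = (real b - real a) * (real b + real a)"
        by (simp add: power2_eq_square algebra_simps)
      then show ?thesis
        using False assms by (simp add: divide_simps)
    qed (simp add: power2_eq_square)
  qed
  also have "\<dots> = ((\<Sum>b=1..N. 1 / (real b - real a)) - (\<Sum>b=1..N. 1 / (real b + real a))) / (2 * real a)
      + 1 / (4 * (real a)\<^sup>2)"
    using assms by (simp add: sum.distrib sum_subtractf flip: sum_divide_distrib)
  also have "\<dots> = 3 / 4 * (1 / (real a)\<^sup>2) - (harm (N + a) - harm (N - a)) / (2 * real a)"
    using assms unfolding sum_inverse_add sum_inverse_diff [OF assms(2)]
    by (simp add: field_simps power2_eq_square)
  finally show ?thesis .
qed

lemma harm_diff_le: "harm (m + d) - harm m \<le> real d / (real m + 1)"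
proof (induction d)
  case (Suc d)
  have "inverse (real (Suc (m + d))) \<le> 1 / (real m + 1)"
    by (simp add: field_simps)
  with Suc show ?case by (simp add: harm_Suc add_divide_distrib)
qed simp

lemma harm_diff_nonneg: "m \<le> n \<Longrightarrow> (0::real) \<le> harm n - harm m"
  using harm_mono [of m n] by simp

text \<open>Partial fractions 1/(a b) = (1/a + 1/b)/(a + b) with b = N - a + 1, so that a + b = N +
  1.\<close>

lemma sum_inverse_products:
  "(\<Sum>a=1..N. 1 / real a * (1 / (real (N - a) + 1))) = 2 * harm N / (real N + 1)"
proof -
  have "(\<Sum>a=1..N. 1 / real a * (1 / (real (N - a) + 1)))
      = (\<Sum>a=1..N. (1 / real a + 1 / (real (N - a) + 1)) / (real N + 1))"
  proof (rule sum.cong [OF refl])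
    fix a assume a: "a \<in> {1..N}"
    define b where "b = real (N - a) + 1"
    have "b > 0" "real N + 1 = real a + b" "real a > 0"
      using a by (auto simp: b_def of_nat_diff)
    then show "1 / real a * (1 / (real (N - a) + 1))
        = (1 / real a + 1 / (real (N - a) + 1)) / (real N + 1)"
      unfolding b_def [symmetric] by (simp add: divide_simps)
  qed
  also have "\<dots> = ((\<Sum>a=1..N. 1 / real a) + (\<Sum>a=1..N. 1 / (real (N - a) + 1))) / (real N + 1)"
    by (simp add: sum.distrib flip: sum_divide_distrib)
  also have "(\<Sum>a=1..N. 1 / (real (N - a) + 1)) = (\<Sum>a=1..N. 1 / real a)"
    by (rule sum.reindex_bij_witness [of _ "\<lambda>a. Suc N - a" "\<lambda>a. Suc N - a"])
      (auto simp: Suc_diff_le add_ac)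
  finally show ?thesis by (simp add: harm_def inverse_eq_divide)
qed

lemma harm_over_n_tendsto_0: "(\<lambda>N. 2 * harm N / (real N + 1)) \<longlonglongrightarrow> 0"
proof -
  have "(\<lambda>N. 2 * (harm N - ln (real N)) * (1 / (real N + 1)) + 2 * ln (real N) / (real N + 1))
      \<longlonglongrightarrow> 2 * euler_mascheroni * 0 + 0"
    by (intro tendsto_add tendsto_mult tendsto_const euler_mascheroni_LIMSEQ) real_asymp+
  then show ?thesis by (simp add: algebra_simps diff_divide_distrib)
qed

text \<open>Euler's recursion for the even zeta values.\<close>
lemma zeta_even_convolution:
  assumes "m \<ge> 1"
  shows "(\<Sum>k=1..m. zeta_even k * zeta_even (Suc m - k)) = (real m + 3 / 2) * zeta_even (Suc m)"
proof (rule LIMSEQ_unique)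
  show "(\<lambda>N. \<Sum>k=1..m. zeta_partial N k * zeta_partial N (Suc m - k))
      \<longlonglongrightarrow> (\<Sum>k=1..m. zeta_even k * zeta_even (Suc m - k))"
    by (intro tendsto_sum tendsto_mult zeta_partial_tendsto) auto
  \<comment> \<open>The part of the off-diagonal sum that tends to 0. The other part, 3/4 of
    \<open>zeta_partial N (Suc m)\<close>, is doubled to give the 3/2.\<close>
  define err where "err = (\<lambda>N. \<Sum>a=1..N. (1 / (real a)\<^sup>2) ^ m
      * ((harm (N + a) - harm (N - a)) / (2 * real a)))"
  have conv: "(\<Sum>k=1..m. zeta_partial N k * zeta_partial N (Suc m - k))
      = (real m + 3 / 2) * zeta_partial N (Suc m) - 2 * err N" for N
  proof -
    have "(\<Sum>a=1..N. (1 / (real a)\<^sup>2) ^ m * (\<Sum>b=1..N. 1 / ((real b)\<^sup>2 - (real a)\<^sup>2)))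
        = (\<Sum>a=1..N. 3 / 4 * (1 / (real a)\<^sup>2) ^ Suc m
            - (1 / (real a)\<^sup>2) ^ m * ((harm (N + a) - harm (N - a)) / (2 * real a)))"
    proof (rule sum.cong [OF refl])
      fix a assume "a \<in> {1..N}"
      then have a: "1 \<le> a" "a \<le> N" by auto
      show "(1 / (real a)\<^sup>2) ^ m * (\<Sum>b=1..N. 1 / ((real b)\<^sup>2 - (real a)\<^sup>2))
          = 3 / 4 * (1 / (real a)\<^sup>2) ^ Suc m
            - (1 / (real a)\<^sup>2) ^ m * ((harm (N + a) - harm (N - a)) / (2 * real a))"
        unfolding sum_inverse_diff_squares [OF a] by (simp only: right_diff_distrib power_Suc mult_ac)
    qed
    also have "\<dots> = 3 / 4 * zeta_partial N (Suc m) - err N"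
      by (simp only: sum_subtractf sum_distrib_left zeta_partial_def err_def)
    finally show ?thesis
      unfolding zeta_partial_convolution by (simp add: algebra_simps)
  qed
  \<comment> \<open>As m >= 1, (1/a^2)^m <= 1/a, and the harmonic difference consists of 2 a terms
    of size at most 1/(N - a + 1). So \<open>err N\<close> is bounded by the sum in
    \<open>sum_inverse_products\<close>.\<close>
  have "err \<longlonglongrightarrow> 0"
  proof (rule tendsto_sandwich [OF _ _ tendsto_const harm_over_n_tendsto_0])
    show "\<forall>\<^sub>F N in sequentially. 0 \<le> err N"
      unfolding err_def
      by (intro always_eventually allI sum_nonneg mult_nonneg_nonneg divide_nonneg_nonneg harm_diff_nonneg) auto
    show "\<forall>\<^sub>F N in sequentially. err N \<le> 2 * harm N / (real N + 1)"
    proof (intro always_eventually allI)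
      fix N
      show "err N \<le> 2 * harm N / (real N + 1)"
        unfolding err_def sum_inverse_products [symmetric]
      proof (intro sum_mono mult_mono)
        fix a assume a: "a \<in> {1..N}"
        have "(1 / (real a)\<^sup>2) ^ m \<le> (1 / (real a)\<^sup>2) ^ 1"
          using a assms by (intro power_decreasing) (auto simp: divide_simps)
        also have "\<dots> \<le> 1 / real a"
          using a by (simp add: field_simps power2_eq_square)
        finally show "(1 / (real a)\<^sup>2) ^ m \<le> 1 / real a" .
        have "harm (N - a + 2 * a) - harm (N - a) \<le> real (2 * a) / (real (N - a) + 1)"
          by (rule harm_diff_le)
        moreover have "N - a + 2 * a = N + a"
          using a by auto
        moreover have "h / x \<le> 1 / y" if "h \<le> x / y" "x > 0" "y > 0" for h x y :: real
          using that by (simp add: field_simps)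
        ultimately show "(harm (N + a) - harm (N - a)) / (2 * real a) \<le> 1 / (real (N - a) + 1)"
          using a by simp
        show "0 \<le> (harm (N + a) - harm (N - a)) / (2 * real a)"
          by (intro divide_nonneg_nonneg harm_diff_nonneg) auto
      qed auto
    qed
  qed
  then have "(\<lambda>N. (real m + 3 / 2) * zeta_partial N (Suc m) - 2 * err N)
      \<longlonglongrightarrow> (real m + 3 / 2) * zeta_even (Suc m) - 2 * 0"
    by (intro tendsto_diff tendsto_mult tendsto_const zeta_partial_tendsto) auto
  then show "(\<lambda>N. \<Sum>k=1..m. zeta_partial N k * zeta_partial N (Suc m - k))
      \<longlonglongrightarrow> (real m + 3 / 2) * zeta_even (Suc m)"
    unfolding conv by simp
qed

text \<open>Strong induction from the Basel sum: in Euler's recursion the products involve smaller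
  arguments only, and the factor m + 3/2 is rational and nonzero.\<close>

lemma rat_pi_zeta_even:
  assumes "k \<ge> 1"
  shows "rat_pi (2 * k) (zeta_even k)"
  using assms
proof (induction k rule: less_induct)
  case (less k)
  show ?case
  proof (cases "k = 1")
    case True
    have "(\<lambda>n. 1 / (real (Suc n))\<^sup>2) sums (pi\<^sup>2 / 6)"
      using inverse_squares_sums by (simp add: add_ac)
    \<comment> \<open>The added term n = 0 is 1/0 = 0.\<close>
    then have "(\<lambda>n. 1 / (real n)\<^sup>2) sums (pi\<^sup>2 / 6)"
      by (subst (asm) sums_Suc_iff) simp
    then have "zeta_even 1 = 1 / 6 * pi\<^sup>2"
      by (simp add: zeta_even_def sums_iff)
    then show ?thesis
      using True by (auto simp: rat_pi_def intro!: bexI [of _ "1 / 6"])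
  next
    case False
    then obtain m where m: "k = Suc m" "m \<ge> 1"
      using less.prems by (cases k) auto
    have "rat_pi (2 * k) (\<Sum>i=1..m. zeta_even i * zeta_even (Suc m - i))"
    proof (rule rat_pi_sum)
      fix i assume i: "i \<in> {1..m}"
      have "rat_pi (2 * i + 2 * (Suc m - i)) (zeta_even i * zeta_even (Suc m - i))"
        using i m by (intro rat_pi_mult less.IH) auto
      moreover have "2 * i + 2 * (Suc m - i) = 2 * k"
        using i m by auto
      ultimately show "rat_pi (2 * k) (zeta_even i * zeta_even (Suc m - i))"
        by simp
    qed
    then have "rat_pi (2 * k) (1 / (real m + 3 / 2) * ((real m + 3 / 2) * zeta_even (Suc m)))"
      unfolding zeta_even_convolution [OF m(2)] by (rule rat_pi_cmult [rotated]) auto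
    moreover have cancel: "1 / c * (c * z) = z" if "c > 0" for c z :: real
      using that by simp
    have "1 / (real m + 3 / 2) * ((real m + 3 / 2) * zeta_even (Suc m)) = zeta_even (Suc m)"
      by (rule cancel) simp
    ultimately show ?thesis
      unfolding m(1) by (simp only:)
  qed
qed

text \<open>The alternating sum is twice its even-indexed part minus the full sum, giving (2/4^k -
  1) \<open>zeta_even k\<close>. Absolute convergence provides a limit, so the partial sums up to
  \<open>2 * N\<close> determine it.\<close>

lemma alternating_zeta_even:
  assumes "k \<ge> 1"
  shows "\<exists>L. rat_pi (2 * k) L \<and> (\<lambda>N. \<Sum>l=1..N. (-1) ^ l / real l ^ (2 * k)) \<longlonglongrightarrow> L"
proof -
  define E where "E = (\<lambda>N. \<Sum>l=1..N. (-1) ^ l / real l ^ (2 * k))"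
  have "summable (\<lambda>l. (-1) ^ l / real l ^ (2 * k))"
  proof (rule summable_comparison_test' [OF summable_inverse_squares_power [OF assms]])
    show "norm ((-1) ^ l / real l ^ (2 * k)) \<le> (1 / (real l)\<^sup>2) ^ k" for l
      by (simp add: power_mult power_one_over abs_divide power_abs)
  qed
  then obtain L where "(\<lambda>N. \<Sum>l\<le>N. (-1) ^ l / real l ^ (2 * k)) \<longlonglongrightarrow> L"
    using summable_LIMSEQ' by blast
  moreover have "(\<Sum>l\<le>N. (-1) ^ l / real l ^ (2 * k)) = E N" for N
    unfolding E_def
    using assms by (intro sum.mono_neutral_right) (auto simp: not_le zero_power Suc_le_eq)
  ultimately have lim: "E \<longlonglongrightarrow> L"
    by simp
  have double: "E (2 * N) = 2 / 4 ^ k * zeta_partial N k - zeta_partial (2 * N) k" for N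
  proof -
    define g where "g = (\<lambda>a::nat. (1 / (real a)\<^sup>2) ^ k)"
    have "(-1) ^ l / real l ^ (2 * k) = (-1) ^ l * g l" for l
      by (simp add: g_def power_mult power_one_over)
    moreover have "g (Suc (Suc (2 * N))) = g (Suc N) / 4 ^ k" for N
    proof -
      have "(real (Suc (Suc (2 * N))))\<^sup>2 = 4 * (real (Suc N))\<^sup>2"
        by (simp add: power2_eq_square algebra_simps)
      then show ?thesis
        by (simp only: g_def) (simp add: power_one_over power_mult_distrib)
    qed
    ultimately show ?thesis
      unfolding E_def zeta_partial_def g_def [symmetric]
      by (induction N) (simp_all add: algebra_simps add_divide_distrib)
  qed
  have "(\<lambda>N. E (2 * N)) \<longlonglongrightarrow> 2 / 4 ^ k * zeta_even k - zeta_even k"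
    unfolding double using assms
    by (intro tendsto_intros zeta_partial_tendsto
        filterlim_compose [OF zeta_partial_tendsto] mult_nat_left_at_top) auto
  moreover have "(\<lambda>N. E (2 * N)) \<longlonglongrightarrow> L"
    by (rule filterlim_compose [OF lim]) (simp add: mult_nat_left_at_top)
  ultimately have "2 / 4 ^ k * zeta_even k - zeta_even k = L"
    by (rule LIMSEQ_unique)
  then have "L = (2 / 4 ^ k - 1) * zeta_even k"
    by (simp add: left_diff_distrib)
  then have "rat_pi (2 * k) L"
    using rat_pi_cmult [OF _ rat_pi_zeta_even [OF assms], of "2 / 4 ^ k - 1"] by simp
  with lim show ?thesis unfolding E_def by blast
qed

subsection \<open>Symmetrised zeta star values\<close>

text \<open>Inductively the tail's sums converge and so are bounded; the outer series is then
  dominated by a multiple of \<open>f x\<close>.\<close>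

lemma trap_sum_convergent:
  assumes summable: "\<And>x. summable (\<lambda>l. \<bar>f x l\<bar>)"
  shows "convergent (trap_sum f xs)"
proof (induction xs)
  case Nil
  have "trap_sum f [] = (\<lambda>N. 1)" by auto
  then show ?case by (simp add: convergent_const)
next
  case (Cons x xs)
  let ?u = "trap_sum f xs"
  from Cons have "Bseq ?u"
    by (rule convergent_imp_Bseq)
  then obtain K where K: "\<bar>?u l\<bar> \<le> K" for l
    by (auto simp: Bseq_def)
  have "summable (\<lambda>l. f x l * (?u l + ?u (l - 1)))"
  proof (rule summable_comparison_test')
    show "summable (\<lambda>l. \<bar>f x l\<bar> * (2 * K))"
      by (intro summable_mult2 summable)
    show "norm (f x l * (?u l + ?u (l - 1))) \<le> \<bar>f x l\<bar> * (2 * K)" for l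
      using K [of l] K [of "l - 1"] by (simp add: abs_mult mult_left_mono)
  qed
  then have "convergent (\<lambda>N. \<Sum>l\<le>N. f x l * (?u l + ?u (l - 1)))"
    by (simp add: summable_iff_convergent')
  then have "convergent (\<lambda>N. (\<Sum>l\<le>N. f x l * (?u l + ?u (l - 1))) - f x 0 * (?u 0 + ?u 0))"
    by (intro convergent_diff convergent_const)
  moreover have "(\<Sum>l\<le>N. f x l * (?u l + ?u (l - 1))) - f x 0 * (?u 0 + ?u 0)
      = trap_sum f (x # xs) N" for N
    by (simp add: atMost_atLeast0 sum.atLeast_Suc_atMost)
  ultimately show ?case by simp
qed

text \<open>Provides the majorant for Tannery's theorem.\<close>

lemma trap_sum_summable_diff:
  assumes summable: "\<And>x. summable (\<lambda>l. \<bar>f x l\<bar>)"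
  shows "summable (\<lambda>k. \<bar>trap_sum f (x # xs) (Suc k) - trap_sum f (x # xs) k\<bar>)"
proof -
  let ?u = "trap_sum f xs"
  have "Bseq ?u"
    by (rule convergent_imp_Bseq [OF trap_sum_convergent [OF summable]])
  then obtain K where K: "\<bar>?u l\<bar> \<le> K" for l
    by (auto simp: Bseq_def)
  show ?thesis
  proof (rule summable_comparison_test')
    show "summable (\<lambda>k. \<bar>f x (Suc k)\<bar> * (2 * K))"
      by (intro summable_mult2 summable_Suc_iff [of "\<lambda>l. \<bar>f x l\<bar>", THEN iffD2] summable)
    show "norm \<bar>trap_sum f (x # xs) (Suc k) - trap_sum f (x # xs) k\<bar> \<le> \<bar>f x (Suc k)\<bar> * (2 * K)" for k
      using trap_sum_diff [of "Suc k" f x xs] K [of k] K [of "Suc k"]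
      by (simp add: abs_mult mult_left_mono)
  qed
qed

text \<open>The weights are bounded by 1 and tend to 1, so Tannery's theorem permits the termwise
  limit. The limit series telescopes, and \<open>trap_sum f xs 0 = 0\<close> because
  \<open>xs\<close> is nonempty.\<close>

lemma zeta_star_eq_lim_trap_sum:
  assumes summable: "\<And>x. summable (\<lambda>l. \<bar>f x l\<bar>)"
    and rep: "binom_rep s (\<lambda>k. \<gamma> * (trap_sum f xs k - trap_sum f xs (k - 1)))" and "xs \<noteq> []"
  shows "zeta_star s = \<gamma> * lim (trap_sum f xs)"
proof (rule zeta_star_eq_limit)
  obtain y ys where xs: "xs = y # ys"
    using \<open>xs \<noteq> []\<close> by (cases xs) auto
  let ?u = "trap_sum f xs"
  \<comment> \<open>The shift to \<open>Suc k\<close> lets the series start at 0; for fixed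
    \<open>n\<close> its terms vanish from \<open>k = n\<close> on.\<close>
  define a where "a = (\<lambda>k n. binom_weight n (Suc k) * (\<gamma> * (?u (Suc k) - ?u k)))"
  have "(\<lambda>n. suminf (\<lambda>k. a k n)) \<longlonglongrightarrow> (\<Sum>k. \<gamma> * (?u (Suc k) - ?u k))"
  proof -
    have "(\<lambda>n. a k n) \<longlonglongrightarrow> \<gamma> * (?u (Suc k) - ?u k)" for k
      using tendsto_mult [OF binom_weight_tendsto_1 tendsto_const, of "Suc k"] by (simp add: a_def)
    moreover have "\<forall>\<^sub>F (k, n) in sequentially \<times>\<^sub>F sequentially.
        norm (a k n) \<le> \<bar>\<gamma>\<bar> * \<bar>?u (Suc k) - ?u k\<bar>"
      using abs_binom_weight_le_1
      by (intro always_eventually) (auto simp: a_def abs_mult intro!: mult_left_le_one_le)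
    moreover have "summable (\<lambda>k. \<bar>\<gamma>\<bar> * \<bar>?u (Suc k) - ?u k\<bar>)"
      unfolding xs by (intro summable_mult trap_sum_summable_diff summable)
    ultimately show ?thesis
      using tannerys_theorem [of a "\<lambda>k. \<gamma> * (?u (Suc k) - ?u k)" sequentially
          "\<lambda>k. \<bar>\<gamma>\<bar> * \<bar>?u (Suc k) - ?u k\<bar>"] by simp
  qed
  moreover have "(\<lambda>k. ?u (Suc k) - ?u k) sums (lim ?u - ?u 0)"
    by (rule telescope_sums)
      (rule convergent_LIMSEQ_iff [THEN iffD1, OF trap_sum_convergent [OF summable]])
  then have "(\<Sum>k. \<gamma> * (?u (Suc k) - ?u k)) = \<gamma> * lim ?u"
    by (simp add: suminf_mult sums_iff) (simp add: xs)
  moreover have "\<forall>\<^sub>F n in sequentially. suminf (\<lambda>k. a k n) = harmonic_star n s"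
  proof (intro eventually_sequentiallyI)
    fix n :: nat assume "1 \<le> n"
    have "suminf (\<lambda>k. a k n) = (\<Sum>k<n. a k n)"
      by (rule suminf_finite) (auto simp: a_def binom_weight_eq_0)
    also have "\<dots> = (\<Sum>k=1..n. binom_weight n k * (\<gamma> * (?u k - ?u (k - 1))))"
      by (rule sum.reindex_bij_witness [of _ "\<lambda>k. k - 1" Suc]) (auto simp: a_def)
    also have "\<dots> = harmonic_star n s"
      using rep \<open>1 \<le> n\<close> by (simp add: binom_rep_def)
    finally show "suminf (\<lambda>k. a k n) = harmonic_star n s" .
  qed
  ultimately show "(\<lambda>n. harmonic_star n s) \<longlonglongrightarrow> \<gamma> * lim ?u"
    using Lim_transform_eventually by fastforce
qed

definition alt_term :: "('a \<Rightarrow> nat) \<Rightarrow> 'a \<Rightarrow> nat \<Rightarrow> real" where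
  "alt_term e i k = (-1) ^ k / real k ^ (2 * e i + 2)"

lemma summable_alt_term: "summable (\<lambda>l. \<bar>alt_term e i l\<bar>)"
  using inverse_power_summable [of "2 * e i + 2", where 'a = real]
  by (simp add: alt_term_def abs_divide power_abs inverse_eq_divide)

text \<open>For odd \<open>card B\<close> the signs multiply to (-1)^l again, so an alternating zeta
  value at an even argument results.\<close>

lemma power_sum_alt_term:
  assumes "finite B" "odd (card B)"
  shows "\<exists>L. rat_pi (\<Sum>i\<in>B. 2 * e i + 2) L \<and> power_sum (alt_term e) B \<longlonglongrightarrow> L"
proof -
  define k where "k = (\<Sum>i\<in>B. e i + 1)"
  have k: "(\<Sum>i\<in>B. 2 * e i + 2) = 2 * k"
    unfolding k_def by (simp add: sum_distrib_left)
  have "B \<noteq> {}"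
    using assms(2) by auto
  then have "0 < k"
    unfolding k_def using assms(1) by (intro sum_pos) auto
  then have "k \<ge> 1" by simp
  have "(\<Prod>i\<in>B. alt_term e i l) = (-1) ^ l / real l ^ (2 * k)" for l
  proof -
    have "(\<Prod>i\<in>B. alt_term e i l) = ((-1) ^ l) ^ card B / real l ^ (\<Sum>i\<in>B. 2 * e i + 2)"
      by (simp only: alt_term_def prod_dividef prod_constant power_sum)
    also have "((-1) ^ l) ^ card B = ((-1) ^ l :: real)"
      using assms(2) by (simp flip: power_mult add: uminus_power_if)
    finally show ?thesis by (simp only: k)
  qed
  then have "power_sum (alt_term e) B = (\<lambda>N. \<Sum>l=1..N. (-1) ^ l / real l ^ (2 * k))"
    by (simp add: power_sum_def fun_eq_iff)
  then show ?thesis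
    using alternating_zeta_even [OF \<open>k \<ge> 1\<close>] by (simp only: k)
qed

text \<open>In \<open>sym_trap_sum_insert\<close> only power sums over odd-sized sets
  \<open>insert j B\<close> survive, multiplied by values at smaller sets. The exponents of pi add
  up because \<open>insert j B\<close> and \<open>J' - B\<close> partition \<open>J\<close>.\<close>

lemma sym_trap_sum_alt_term:
  assumes "finite J"
  shows "\<exists>L. rat_pi (\<Sum>i\<in>J. 2 * e i + 2) L \<and> sym_trap_sum (alt_term e) J \<longlonglongrightarrow> L"
  using assms
proof (induction J rule: finite_psubset_induct)
  case (psubset J)
  show ?case
  proof (cases "J = {}")
    case True
    have "sym_trap_sum (alt_term e) {} = (\<lambda>N. 1)" by auto
    then show ?thesis
      using True by (intro exI [of _ 1]) (auto simp: rat_pi_def)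
  next
    case False
    then obtain j where "j \<in> J" by blast
    then obtain J' where J: "J = insert j J'" "j \<notin> J'"
      by (rule Set.set_insert)
    with psubset.hyps have fin: "finite J'" by simp
    define c where "c = (\<lambda>B :: 'a set. if even (card B) then 2 * fact (card B) else 0 :: real)"
    have "\<exists>L. rat_pi (\<Sum>i\<in>J. 2 * e i + 2) L \<and> (\<lambda>N. c B * power_sum (alt_term e) (insert j B) N
        * sym_trap_sum (alt_term e) (J' - B) N) \<longlonglongrightarrow> L" if B: "B \<in> Pow J'" for B
    proof (cases "even (card B)")
      case True
      from B fin have finB: "finite B" by (auto intro: finite_subset)
      from finB B J True have "odd (card (insert j B))"
        by (subst card_insert_disjoint) auto
      then obtain P where P: "rat_pi (\<Sum>i\<in>insert j B. 2 * e i + 2) P"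
        "power_sum (alt_term e) (insert j B) \<longlonglongrightarrow> P"
        using power_sum_alt_term [of "insert j B" e] finB by blast
      obtain S where S: "rat_pi (\<Sum>i\<in>J' - B. 2 * e i + 2) S"
        "sym_trap_sum (alt_term e) (J' - B) \<longlonglongrightarrow> S"
        using psubset.IH [of "J' - B"] J by auto
      have "J = insert j B \<union> (J' - B)"
        using B J by auto
      then have "(\<Sum>i\<in>J. 2 * e i + 2) = (\<Sum>i\<in>insert j B. 2 * e i + 2) + (\<Sum>i\<in>J' - B. 2 * e i + 2)"
        using J(2) fin finB by (simp only:) (rule sum.union_disjoint, auto)
      moreover have "c B \<in> \<rat>"
      proof -
        have "c B = of_nat (if even (card B) then 2 * fact (card B) else 0)"
          by (simp add: c_def)
        then show ?thesis by (simp only: Rats_of_nat)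
      qed
      ultimately have "rat_pi (\<Sum>i\<in>J. 2 * e i + 2) (c B * (P * S))"
        by (simp only: rat_pi_cmult rat_pi_mult [OF P(1) S(1)])
      moreover have "(\<lambda>N. c B * power_sum (alt_term e) (insert j B) N
          * sym_trap_sum (alt_term e) (J' - B) N) \<longlonglongrightarrow> c B * P * S"
        by (intro tendsto_mult tendsto_const P S)
      ultimately show ?thesis by (auto simp: mult.assoc)
    next
      case False
      then show ?thesis
        by (intro exI [of _ 0]) (auto simp: c_def rat_pi_def)
    qed
    then obtain L where L: "\<And>B. B \<in> Pow J' \<Longrightarrow> rat_pi (\<Sum>i\<in>J. 2 * e i + 2) (L B)"
      "\<And>B. B \<in> Pow J' \<Longrightarrow> (\<lambda>N. c B * power_sum (alt_term e) (insert j B) N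
        * sym_trap_sum (alt_term e) (J' - B) N) \<longlonglongrightarrow> L B"
      by metis
    have "sym_trap_sum (alt_term e) J = (\<lambda>N. \<Sum>B\<in>Pow J'. c B * power_sum (alt_term e) (insert j B) N
        * sym_trap_sum (alt_term e) (J' - B) N)"
      unfolding J(1) c_def by (rule ext) (rule sym_trap_sum_insert [OF fin J(2)])
    moreover have "\<dots> \<longlonglongrightarrow> (\<Sum>B\<in>Pow J'. L B)"
      by (intro tendsto_sum L(2))
    ultimately have "sym_trap_sum (alt_term e) J \<longlonglongrightarrow> (\<Sum>B\<in>Pow J'. L B)"
      by (simp only:)
    moreover have "rat_pi (\<Sum>i\<in>J. 2 * e i + 2) (\<Sum>B\<in>Pow J'. L B)"
      by (intro rat_pi_sum L(1))
    ultimately show ?thesis by blast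
  qed
qed

section \<open>The compositions of the theorem\<close>

lemma upt_1_Suc_Suc: "[1..<Suc (Suc (Suc n))] = 1 # 2 # map (\<lambda>j. j + 2) [1..<Suc n]"
  by (simp add: upt_conv_Cons numeral_2_eq_2 comp_def flip: map_Suc_upt del: upt_Suc)

text \<open>A shift by two preserves parity, so the remaining blocks again start with a 3.\<close>

lemma blocks31_Suc_Suc:
  "blocks31 (Suc (Suc n)) a
     = replicate (a 1) 2 @ 3 # replicate (a 2) 2 @ 1 # blocks31 n (\<lambda>j. a (j + 2))"
  unfolding blocks31_def upt_1_Suc_Suc by (simp add: comp_def del: upt_Suc)

lemma map_upt_Suc_Suc:
  "map g [1..<Suc (Suc (Suc n))] = g 1 # g 2 # map (\<lambda>j. g (j + 2)) [1..<Suc n]"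
  unfolding upt_1_Suc_Suc by (simp add: comp_def del: upt_Suc)

text \<open>Induction on the number of pairs of blocks: \<open>binom_rep_Cons_1\<close> brings the
  inner pairs into the form that \<open>binom_rep_block\<close> expects. The last 1 of the blocks is
  the one in \<open>1 # s\<close>, so at least one pair is present.\<close>

lemma binom_rep_blocks31:
  fixes e :: "nat \<Rightarrow> nat"
  defines "f \<equiv> alt_term e"
  assumes base: "binom_rep (1 # s) (\<lambda>l. \<gamma> * (trap_sum f xs l + trap_sum f xs (l - 1)) / real l)"
  shows "binom_rep (blocks31 (2 * Suc r) (\<lambda>j. e (g j)) @ s)
    (\<lambda>k. \<gamma> * (trap_sum f (map g [1..<Suc (2 * Suc r)] @ xs) k
              - trap_sum f (map g [1..<Suc (2 * Suc r)] @ xs) (k - 1)))"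
proof (induction r arbitrary: g)
  case 0
  have two: "2 * Suc 0 = Suc (Suc 0)" by simp
  have "blocks31 (2 * Suc 0) (\<lambda>j. e (g j)) @ s
      = replicate (e (g 1)) 2 @ 3 # replicate (e (g 2)) 2 @ 1 # s"
    unfolding two blocks31_Suc_Suc by (simp add: blocks31_def)
  moreover have "map g [1..<Suc (2 * Suc 0)] @ xs = g 1 # g 2 # xs"
    unfolding two map_upt_Suc_Suc by simp
  ultimately show ?case
    using binom_rep_block [of s \<gamma> e xs "g 1" "g 2"] base by (simp only: f_def alt_term_def [abs_def])
next
  case (Suc r)
  define h where "h = (\<lambda>j. g (j + 2))"
  define ys where "ys = map h [1..<Suc (2 * Suc r)] @ xs"
  \<comment> \<open>Nonemptiness gives the value 0 at 0 that \<open>binom_rep_Cons_1\<close>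
    requires.\<close>
  have nonempty: "ys = h 1 # tl ys"
    unfolding ys_def by (simp add: upt_conv_Cons del: upt_Suc)
  have "trap_sum f ys 0 = 0"
    by (subst nonempty) simp
  then have "binom_rep (1 # blocks31 (2 * Suc r) (\<lambda>j. e (h j)) @ s)
      (\<lambda>l. \<gamma> * (trap_sum f ys l + trap_sum f ys (l - 1)) / real l)"
    using Suc.IH [of h] unfolding ys_def by (intro binom_rep_Cons_1)
  then have "binom_rep (replicate (e (g 1)) 2 @ 3 # replicate (e (g 2)) 2 @ 1
        # (blocks31 (2 * Suc r) (\<lambda>j. e (h j)) @ s))
      (\<lambda>k. \<gamma> * (trap_sum f (g 1 # g 2 # ys) k - trap_sum f (g 1 # g 2 # ys) (k - 1)))"
    unfolding f_def alt_term_def [abs_def] by (rule binom_rep_block)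
  moreover have "blocks31 (2 * Suc (Suc r)) (\<lambda>j. e (g j)) @ s
      = replicate (e (g 1)) 2 @ 3 # replicate (e (g 2)) 2 @ 1
        # (blocks31 (2 * Suc r) (\<lambda>j. e (h j)) @ s)"
    using blocks31_Suc_Suc [of "2 * Suc r" "\<lambda>j. e (g j)"] by (simp add: h_def)
  moreover have "map g [1..<Suc (2 * Suc (Suc r))] @ xs = g 1 # g 2 # ys"
    using map_upt_Suc_Suc [of g "2 * Suc r"] by (simp add: h_def ys_def del: upt_Suc)
  ultimately show ?case by (simp only:)
qed

text \<open>The limits, summed over all permutations, give the limit of \<open>sym_trap_sum\<close>.
  The two parts of the theorem use \<open>\<gamma>\<close> equal to 1 and -1.\<close>

lemma rat_pi_sum_zeta_star:
  assumes zeta: "\<And>\<tau>. \<tau> permutes {1..n} \<Longrightarrow>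
      zeta_star (S \<tau>) = \<gamma> * lim (trap_sum (alt_term e) (map \<tau> [1..<Suc n]))"
    and "\<gamma> \<in> \<rat>"
  shows "rat_pi (2 * (\<Sum>j=1..n. e j) + 2 * n) (\<Sum>\<tau> | \<tau> permutes {1..n}. zeta_star (S \<tau>))"
proof -
  let ?u = "trap_sum (alt_term e)"
  obtain L where L: "rat_pi (\<Sum>i=1..n. 2 * e i + 2) L"
    "sym_trap_sum (alt_term e) {1..n} \<longlonglongrightarrow> L"
    using sym_trap_sum_alt_term [of "{1..n}" e] by auto
  have "(\<lambda>N. \<Sum>xs\<in>permutations_of_set {1..n}. ?u xs N)
      \<longlonglongrightarrow> (\<Sum>xs\<in>permutations_of_set {1..n}. lim (?u xs))"
    by (intro tendsto_sum convergent_LIMSEQ_iff [THEN iffD1]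
        trap_sum_convergent [OF summable_alt_term])
  then have lim: "(\<Sum>xs\<in>permutations_of_set {1..n}. lim (?u xs)) = L"
    using L(2) unfolding sym_trap_sum_def by (rule LIMSEQ_unique)
  have "(\<Sum>\<tau> | \<tau> permutes {1..n}. zeta_star (S \<tau>))
      = \<gamma> * (\<Sum>\<tau> | \<tau> permutes {1..n}. lim (?u (map \<tau> [1..<Suc n])))"
    using zeta by (simp add: sum_distrib_left del: upt_Suc)
  also have "\<dots> = \<gamma> * L"
    by (simp only: sum_permutes_eq_permutations_of_set [where F = "\<lambda>xs. lim (?u xs)"] lim)
  finally have "rat_pi (\<Sum>i=1..n. 2 * e i + 2) (\<Sum>\<tau> | \<tau> permutes {1..n}. zeta_star (S \<tau>))"
    using rat_pi_cmult [OF \<open>\<gamma> \<in> \<rat>\<close> L(1)] by (simp only:)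
  moreover have "(\<Sum>i=1..n. 2 * e i + 2) = 2 * (\<Sum>j=1..n. e j) + 2 * n"
    by (simp only: sum.distrib sum_distrib_left [symmetric] sum_constant) simp
  ultimately show ?thesis by (simp only:)
qed

theorem theorem8p2:
  fixes r :: nat and e :: "nat \<Rightarrow> nat"
  assumes "r \<ge> 1"
  shows "(\<exists>q\<in>\<rat>. (\<Sum>\<tau> | \<tau> permutes {1..2*r}. zeta_star (blocks31 (2*r) (\<lambda>j. e (\<tau> j))))
            = q * pi ^ (2 * (\<Sum>j=1..2*r. e j) + 4*r))
       \<and> (\<exists>q\<in>\<rat>. (\<Sum>\<tau> | \<tau> permutes {1..2*r+1}.
              zeta_star (blocks31 (2*r) (\<lambda>j. e (\<tau> j)) @ replicate (e (\<tau> (2*r+1)) + 1) 2))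
            = q * pi ^ (2 * (\<Sum>j=1..2*r+1. e j) + 4*r + 2))"
proof
  let ?f = "alt_term e"
  obtain r' where r: "r = Suc r'"
    using assms by (cases r) auto
  have "zeta_star (blocks31 (2 * r) (\<lambda>j. e (\<tau> j))) = 1 * lim (trap_sum ?f (map \<tau> [1..<Suc (2 * r)]))"
    for \<tau>
  proof (rule zeta_star_eq_lim_trap_sum [OF summable_alt_term])
    \<comment> \<open>In (i) nothing follows the last 1, so the start is the empty list with
      \<open>\<gamma> = 1\<close>.\<close>
    have "binom_rep [1] (\<lambda>l. 1 * (trap_sum ?f [] l + trap_sum ?f [] (l - 1)) / real l)"
      using binom_rep_1 by simp
    from binom_rep_blocks31 [OF this, of r' \<tau>]
    show "binom_rep (blocks31 (2 * r) (\<lambda>j. e (\<tau> j)))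
        (\<lambda>k. 1 * (trap_sum ?f (map \<tau> [1..<Suc (2 * r)]) k
                  - trap_sum ?f (map \<tau> [1..<Suc (2 * r)]) (k - 1)))"
      by (simp only: r append_Nil2)
  qed (simp add: r)
  then have "rat_pi (2 * (\<Sum>j=1..2*r. e j) + 2 * (2 * r))
      (\<Sum>\<tau> | \<tau> permutes {1..2*r}. zeta_star (blocks31 (2*r) (\<lambda>j. e (\<tau> j))))"
    by (rule rat_pi_sum_zeta_star) auto
  then show "\<exists>q\<in>\<rat>. (\<Sum>\<tau> | \<tau> permutes {1..2*r}. zeta_star (blocks31 (2*r) (\<lambda>j. e (\<tau> j))))
            = q * pi ^ (2 * (\<Sum>j=1..2*r. e j) + 4*r)"
    by (simp add: rat_pi_def)
  have "zeta_star (blocks31 (2*r) (\<lambda>j. e (\<tau> j)) @ replicate (e (\<tau> (2*r+1)) + 1) 2)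
      = - 1 * lim (trap_sum ?f (map \<tau> [1..<Suc (2 * r + 1)]))" for \<tau>
  proof (rule zeta_star_eq_lim_trap_sum [OF summable_alt_term])
    define x where "x = \<tau> (2 * r + 1)"
    \<comment> \<open>In (ii) the extra 2 in the last block raises its exponent to 2 e(x) + 2, as
      for all other blocks. The coefficients -2 \<open>alt_term e x k\<close> are the negated
      differences of \<open>trap_sum ?f [x]\<close>, hence the sign -1.\<close>
    have "binom_rep (replicate (e x + 1) 2 @ []) (\<lambda>k. - 2 * (-1) ^ k / real k ^ (2 * (e x + 1)))"
      by (rule binom_rep_replicate_2 [OF binom_rep_Nil])
    then have "binom_rep (replicate (e x + 1) 2)
        (\<lambda>k. - 1 * (trap_sum ?f [x] k - trap_sum ?f [x] (k - 1)))"
      unfolding append_Nil2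
      by (rule binom_rep_cong) (simp only: trap_sum_diff, simp add: alt_term_def)
    from binom_rep_blocks31 [OF binom_rep_Cons_1 [OF this], of r' \<tau>]
    show "binom_rep (blocks31 (2*r) (\<lambda>j. e (\<tau> j)) @ replicate (e (\<tau> (2*r+1)) + 1) 2)
        (\<lambda>k. - 1 * (trap_sum ?f (map \<tau> [1..<Suc (2 * r + 1)]) k
                  - trap_sum ?f (map \<tau> [1..<Suc (2 * r + 1)]) (k - 1)))"
      by (simp add: r x_def)
  qed simp
  then have "rat_pi (2 * (\<Sum>j=1..2*r+1. e j) + 2 * (2 * r + 1))
      (\<Sum>\<tau> | \<tau> permutes {1..2*r+1}.
        zeta_star (blocks31 (2*r) (\<lambda>j. e (\<tau> j)) @ replicate (e (\<tau> (2*r+1)) + 1) 2))"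
    by (rule rat_pi_sum_zeta_star) auto
  then show "\<exists>q\<in>\<rat>. (\<Sum>\<tau> | \<tau> permutes {1..2*r+1}.
              zeta_star (blocks31 (2*r) (\<lambda>j. e (\<tau> j)) @ replicate (e (\<tau> (2*r+1)) + 1) 2))
            = q * pi ^ (2 * (\<Sum>j=1..2*r+1. e j) + 4*r + 2)"
    unfolding rat_pi_def by (simp only: distrib_left mult.assoc [symmetric]) simp
qed

end
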